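(* Let $\mu$ be a measure of $n$-polynomial growth on $\mathbb{R}^d$. Fix $\alpha>60$ and $C_0>(6\sqrt{d}\,\alpha)^d$, and set $\alpha_0=6\sqrt{d}\,\alpha$. Then there exist $N=N(d)$ (a number depending only on $d$, and in particular not on $\alpha_0$) atomic filtrations $\Sigma^1,\Sigma^2,\dots,\Sigma^N$ of $\mathrm{supp}(\mu)\subset\mathbb{R}^d$ with the following properties: (1) For each $1\le k\le N$ and each atom $T\in\Sigma^k$ there exists a ball $B_T$ such that $$B_T\cap\mathrm{supp}(\mu)\subset T\subset 30B_T\cap\mathrm{supp}(\mu)\quad\text{and}\quad \mu(\alpha B_T)\le C_0\,\mu(B_T).$$ (2) For each $(\alpha_0,C_0)$-doubling cube $Q$ in $\mathbb{R}^d$ there exist $1\le k\le N$ and $T\in\Sigma^k$ such that $$Q\cap\mathrm{supp}(\mu)\subset T,\qquad \ell(Q)\sim r(B_T)\qquad\text{and}\qquad \mu(Q)\sim\mu(T),$$ where $B_T$ is the ball associated with $T$ in (1).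
   Context: A measure $\mu$ on $\mathbb{R}^d$ has $n$-polynomial growth ($0<n\le d$) if it is a Radon measure such that $\mu(B(x,r))\le C_\mu r^n$ for $\mu$-a.e. $x$ and all $r>0$; as a standing normalization one takes $C_\mu=1$. Cubes are Euclidean cubes with sides parallel to the axes; $\ell(Q)$ is the side length of $Q$, $r(B)$ is the radius of the ball $B$, and for $\lambda>0$, $\lambda Q$ and $\lambda B$ denote the concentric dilates by the factor $\lambda$. For $\alpha>1$, $\beta>0$, a cube or ball $Q$ is $(\alpha,\beta)$-doubling if $\mu(\alpha Q)\le\beta\mu(Q)$; doubling cubes are understood to have positive $\mu$-measure. An atomic filtration $\Sigma$ of $\mathrm{supp}(\mu)$ is a two-sided filtration of atomic $\sigma$-algebras generated by a sequence $\{\Sigma_k\}_{k\in\mathbb{Z}}$ of nested countable partitions of $\mathrm{supp}(\mu)$ into Borel sets, i.e. every element of $\Sigma_{k+1}$ is contained in an element of $\Sigma_k$. The elements of the partitions are called the atoms, and $T\in\Sigma$ means that $T\in\Sigma_k$ for some $k$. $A\sim B$ means $c^{-1}B\le A\le cB$ for a constant $c\ge1$ depending only on $d,n,\alpha,C_0$ (not on the cube $Q$).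
   Formalization: Each generation partitions supp(μ) only up to a μ-null set, since exact partitions are impossible for some rapidly decaying measures on the line; the ball B_T may depend on the generation of the atom T, as one set can be an atom of several generations. *)

theory Defs
  imports "HOL-Analysis.Analysis"
begin

definition radon_measure :: "'a::topological_space measure \<Rightarrow> bool" where
  "radon_measure M \<longleftrightarrow>
     sets M = sets borel \<and>
     (\<forall>K. compact K \<longrightarrow> emeasure M K < \<infinity>) \<and>
     (\<forall>A\<in>sets borel. emeasure M A = (INF U\<in>{U. open U \<and> A \<subseteq> U}. emeasure M U)) \<and>
     (\<forall>U. open U \<longrightarrow> emeasure M U = (SUP K\<in>{K. compact K \<and> K \<subseteq> U}. emeasure M K))"

(* The growth constant is normalized to 1. *)
definition polynomial_growth :: "real \<Rightarrow> 'a::metric_space measure \<Rightarrow> bool" where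
  "polynomial_growth n M \<longleftrightarrow>
     radon_measure M \<and> (AE x in M. \<forall>r>0. emeasure M (ball x r) \<le> ennreal (r powr n))"

definition msupport :: "'a::topological_space measure \<Rightarrow> 'a set" where
  "msupport M = {x. \<forall>U. open U \<and> x \<in> U \<longrightarrow> emeasure M U > 0}"

(* The closed cube with centre x and side length l; its dilate by t is cube x (t * l). *)
definition cube :: "real ^ 'd \<Rightarrow> real \<Rightarrow> (real ^ 'd) set" where
  "cube x l = cbox (\<chi> i. x $ i - l / 2) (\<chi> i. x $ i + l / 2)"

definition doubling_cube ::
  "(real ^ 'd) measure \<Rightarrow> real \<Rightarrow> real \<Rightarrow> real ^ 'd \<Rightarrow> real \<Rightarrow> bool" where
  "doubling_cube M a b x l \<longleftrightarrow>
     0 < l \<and> 0 < emeasure M (cube x l) \<and>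
     emeasure M (cube x (a * l)) \<le> ennreal b * emeasure M (cube x l)"

(* The generations partition the support up to a null set, as usual for filtrations of a
   measure space.  Demanding atoms through every point of the support would be inconsistent
   with the doubling balls of atoms_near_balls below: for a suitable rapidly decaying measure
   on the line there is an unbounded sequence of points p of the support such that every
   doubling ball B with p in 30 B meets one fixed bounded set.
   All inclusions between atoms are exact. *)
definition atomic_filtration ::
  "'a::topological_space measure \<Rightarrow> (int \<Rightarrow> 'a set set) \<Rightarrow> bool" where
  "atomic_filtration M S \<longleftrightarrow>
     (\<forall>j. (\<exists>Z\<in>null_sets M. partition_on (msupport M - Z) (S j)) \<and>
          countable (S j) \<and> S j \<subseteq> sets borel) \<and>
     (\<forall>j. \<forall>T\<in>S (j + 1). \<exists>T'\<in>S j. T \<subseteq> T')"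

(* The ball attached to an atom T of generation j is ball (z j T) (r j T).  It depends on j
   and not only on the set T, since one set may be an atom of several generations: if the
   support of M is compact and nonempty, all large cubes containing it are doubling, and the
   only atom containing their trace on the support is the support itself, so radii comparable
   to all their side lengths must occur for this one set. *)
definition atoms_near_balls ::
  "(real ^ 'd) measure \<Rightarrow> real \<Rightarrow> real \<Rightarrow> (int \<Rightarrow> (real ^ 'd) set set) \<Rightarrow>
   (int \<Rightarrow> (real ^ 'd) set \<Rightarrow> real ^ 'd) \<Rightarrow> (int \<Rightarrow> (real ^ 'd) set \<Rightarrow> real) \<Rightarrow> bool" where
  "atoms_near_balls M \<alpha> C\<^sub>0 S z r \<longleftrightarrow>
     (\<forall>j. \<forall>T\<in>S j. 0 < r j T \<and>
        ball (z j T) (r j T) \<inter> msupport M \<subseteq> T \<and>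
        T \<subseteq> ball (z j T) (30 * r j T) \<inter> msupport M \<and>
        emeasure M (ball (z j T) (\<alpha> * r j T)) \<le> ennreal C\<^sub>0 * emeasure M (ball (z j T) (r j T)))"

end

theory Submission
  imports Defs
begin

text \<open>Fix scales \<open>\<rho> i\<close> with ratio \<open>1/4\<close> and call a ball of radius \<open>\<rho> i\<close> admissible if it is
  doubling and has positive measure. Suppose that for each \<open>i\<close> the centres of some admissible
  balls of radius \<open>\<rho> i\<close> are \<open>4 * \<rho> i\<close>-separated. Then the connected components
  of the balls of all generations \<open>i \<ge> j\<close> have a unique largest ball, and they are contained in its
  double; intersected with the support, these components are the atoms of generation \<open>j\<close>. Nesting is
  automatic. If the separated sets are maximal, the atoms cover almost everything: almost every point
  is the centre of arbitrarily small admissible balls, so by maximality the uncovered set is porous,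
  with holes that are doubling balls, and Vitali's covering lemma shows that it is null.

  To capture the doubling cubes \<open>Q\<close> with side length between \<open>4 powr - i\<close> and \<open>4 * 4 powr - i\<close>,
  pick one centre of such a cube in each cell of a grid of mesh \<open>4 powr - i\<close>. The ball of radius
  \<open>\<rho> i = 3 * sqrt d * 4 powr - i\<close> around it contains all these cubes with centres in that cell, and
  it is admissible. Colouring the cells by their indices modulo a number depending only on \<open>d\<close> makes
  the centres of each colour \<open>4 * \<rho> i\<close>-separated; each colour gives one filtration, built from
  maximal separated sets containing these centres.\<close>

subsection \<open>Components of separated balls\<close>

text \<open>Zorn's lemma among the separated sets between \<open>P\<close> and \<open>E\<close>: a
  point of \<open>E\<close> far from a maximal one could be added to it. Keeping \<open>P\<close>
  lets prescribed centres survive in the nets.\<close>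

lemma maximal_separated_superset:
  fixes P E :: "'a::metric_space set" and \<delta> :: real
  assumes "P \<subseteq> E" and \<delta>: "0 < \<delta>"
    and P: "\<And>x y. x \<in> P \<Longrightarrow> y \<in> P \<Longrightarrow> x \<noteq> y \<Longrightarrow> \<delta> \<le> dist x y"
  shows "\<exists>S. P \<subseteq> S \<and> S \<subseteq> E \<and> (\<forall>x\<in>S. \<forall>y\<in>S. x \<noteq> y \<longrightarrow> \<delta> \<le> dist x y) \<and> (\<forall>x\<in>E. \<exists>y\<in>S. dist x y < \<delta>)"
proof -
  define \<A> where "\<A> = {S. P \<subseteq> S \<and> S \<subseteq> E \<and> (\<forall>x\<in>S. \<forall>y\<in>S. x \<noteq> y \<longrightarrow> \<delta> \<le> dist x y)}"
  have "\<exists>M\<in>\<A>. \<forall>X\<in>\<A>. M \<subseteq> X \<longrightarrow> X = M"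
  proof (rule subset_Zorn_nonempty)
    show "\<A> \<noteq> {}"
      using assms by (auto simp: \<A>_def)
  next
    fix \<C> assume "\<C> \<noteq> {}" and chain: "subset.chain \<A> \<C>"
    have "\<delta> \<le> dist x y" if "x \<in> X" "X \<in> \<C>" "y \<in> Y" "Y \<in> \<C>" "x \<noteq> y" for x y X Y
    proof -
      have "X \<subseteq> Y \<or> Y \<subseteq> X" "X \<in> \<A>" "Y \<in> \<A>"
        using chain that by (auto simp: subset_chain_def)
      with that show ?thesis
        unfolding \<A>_def by blast
    qed
    moreover have "P \<subseteq> \<Union>\<C>" "\<Union>\<C> \<subseteq> E"
      using \<open>\<C> \<noteq> {}\<close> chain by (fastforce simp: subset_chain_def \<A>_def)+
    ultimately show "\<Union>\<C> \<in> \<A>"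
      unfolding \<A>_def by blast
  qed
  then obtain S where S: "S \<in> \<A>" and max: "\<And>X. X \<in> \<A> \<Longrightarrow> S \<subseteq> X \<Longrightarrow> X = S"
    by blast
  have "\<exists>y\<in>S. dist x y < \<delta>" if "x \<in> E" for x
  proof (rule ccontr)
    assume neg: "\<not> (\<exists>y\<in>S. dist x y < \<delta>)"
    then have "insert x S \<in> \<A>"
      using S that by (auto simp: \<A>_def dist_commute not_less)
    then have "x \<in> S"
      using max by blast
    with neg \<delta> show False
      by auto
  qed
  with S show ?thesis
    unfolding \<A>_def by (intro exI[of _ S]) simp
qed

locale scaled_nets =
  fixes \<rho> :: "int \<Rightarrow> real" and S :: "int \<Rightarrow> 'a::metric_space set"
  assumes scale_pos: "0 < \<rho> i"
    and scale_Suc: "\<rho> (i + 1) = \<rho> i / 4"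
    and separated: "x \<in> S i \<Longrightarrow> y \<in> S i \<Longrightarrow> x \<noteq> y \<Longrightarrow> 4 * \<rho> i \<le> dist x y"
begin

text \<open>A node records its generation, since one point may be a centre in several generations,
  with balls of different radii.\<close>

definition nodes :: "int set \<Rightarrow> (int \<times> 'a) set" where
  "nodes I = {(i, x). i \<in> I \<and> x \<in> S i}"

definition node_ball :: "int \<times> 'a \<Rightarrow> 'a set" where
  "node_ball p = ball (snd p) (\<rho> (fst p))"

definition links :: "int set \<Rightarrow> ((int \<times> 'a) \<times> (int \<times> 'a)) set" where
  "links I = {(p, q). p \<in> nodes I \<and> q \<in> nodes I \<and> node_ball p \<inter> node_ball q \<noteq> {}}"

lemma links_sym: "sym (links I)"
  by (auto simp: sym_def links_def)

lemma connected_sym: "(p, q) \<in> (links I)\<^sup>* \<Longrightarrow> (q, p) \<in> (links I)\<^sup>*"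
  using sym_rtrancl[OF links_sym] by (rule symD)

lemma links_mono: "I \<subseteq> J \<Longrightarrow> links I \<subseteq> links J"
  by (auto simp: links_def nodes_def)

lemma connected_mono: "I \<subseteq> J \<Longrightarrow> (p, q) \<in> (links I)\<^sup>* \<Longrightarrow> (p, q) \<in> (links J)\<^sup>*"
  using rtrancl_mono[OF links_mono] by blast

lemma connected_node: "(p, q) \<in> (links I)\<^sup>* \<Longrightarrow> p \<in> nodes I \<Longrightarrow> q \<in> nodes I"
  by (induction rule: rtrancl_induct) (auto simp: links_def)

text \<open>A chain has finitely many links and so involves finitely many generations. This reduces
  diameter bounds to an induction on the number of generations.\<close>

lemma connected_bounded_below:
  assumes "(p, q) \<in> (links {j..})\<^sup>*"
  obtains J where "(p, q) \<in> (links {j..J})\<^sup>*"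
  using assms
proof (induction arbitrary: thesis rule: rtrancl_induct)
  case base
  then show ?case by blast
next
  case (step q r)
  obtain J where J: "(p, q) \<in> (links {j..J})\<^sup>*"
    using step.IH by blast
  define K where "K = max J (max (fst q) (fst r))"
  have "(q, r) \<in> links {j..K}"
    using step.hyps by (auto simp: links_def nodes_def K_def)
  moreover have "(p, q) \<in> (links {j..K})\<^sup>*"
    by (rule connected_mono[OF _ J]) (auto simp: K_def)
  ultimately show ?case
    using step.prems by (blast intro: rtrancl_into_rtrancl)
qed

text \<open>Two balls of generation \<open>j\<close> are so far apart that a chain of balls of later
  generations, which has diameter less than \<open>4 * \<rho> (j + 1) = \<rho> j\<close>, cannot link them.
  Hence a chain leaving a ball of generation \<open>j\<close> never reaches another one.\<close>

lemma dist_connected_aux: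
  assumes IH: "\<And>p q u v. p \<in> nodes {j+1..J} \<Longrightarrow> (p, q) \<in> (links {j+1..J})\<^sup>* \<Longrightarrow>
      u \<in> node_ball p \<Longrightarrow> v \<in> node_ball q \<Longrightarrow> dist u v < 4 * \<rho> (j + 1)"
    and p: "p \<in> nodes {j..J}" "fst p = j" and pq: "(p, q) \<in> (links {j..J})\<^sup>*"
  shows "q = p \<or> (\<exists>q'. node_ball p \<inter> node_ball q' \<noteq> {} \<and> q' \<in> nodes {j+1..J} \<and>
      (q', q) \<in> (links {j+1..J})\<^sup>*)"
  using pq
proof (induction rule: rtrancl_induct)
  case base
  then show ?case by simp
next
  case (step q r)
  have qr: "q \<in> nodes {j..J}" "r \<in> nodes {j..J}" "node_ball q \<inter> node_ball r \<noteq> {}"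
    using step.hyps by (auto simp: links_def)
  show ?case
  proof (cases "fst r = j")
    case True
    \<comment> \<open>A chain that is back in generation \<open>j\<close> joins centres less than
      \<open>3 * \<rho> j\<close> apart, so separation forces \<open>r\<close> to be
      \<open>p\<close> itself.\<close>
    have "dist (snd p) (snd r) < 4 * \<rho> j"
      using step.IH
    proof
      assume "q = p"
      then obtain w where "dist (snd p) w < \<rho> j" "dist (snd r) w < \<rho> j"
        using qr(3) True p(2) by (auto simp: node_ball_def)
      then show ?thesis
        using dist_triangle2[of "snd p" "snd r" w] scale_pos[of j] by linarith
    next
      assume "\<exists>q'. node_ball p \<inter> node_ball q' \<noteq> {} \<and> q' \<in> nodes {j+1..J} \<and>
        (q', q) \<in> (links {j+1..J})\<^sup>*"
      then obtain q' u v where q': "q' \<in> nodes {j+1..J}" "(q', q) \<in> (links {j+1..J})\<^sup>*"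
        and u: "u \<in> node_ball p" "u \<in> node_ball q'"
        and v: "v \<in> node_ball q" "v \<in> node_ball r"
        using qr(3) by auto
      have "dist u v < \<rho> j"
        using IH[OF q' u(2) v(1)] scale_Suc[of j] by simp
      moreover have "dist (snd p) u < \<rho> j" "dist (snd r) v < \<rho> j"
        using u v True p(2) by (auto simp: node_ball_def)
      ultimately show ?thesis
        using dist_triangle[of "snd p" "snd r" u] dist_triangle2[of u "snd r" v] scale_pos[of j]
        by linarith
    qed
    then have "snd p = snd r"
      using separated[of "snd p" j "snd r"] p qr(2) True by (force simp: nodes_def)
    with True p(2) show ?thesis
      by (simp add: prod_eq_iff)
  next
    case False
    then have r: "r \<in> nodes {j+1..J}"
      using qr(2) by (auto simp: nodes_def)
    show ?thesis
      using step.IH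
    proof
      assume "q = p"
      then show ?thesis
        using r qr(3) by blast
    next
      assume "\<exists>q'. node_ball p \<inter> node_ball q' \<noteq> {} \<and> q' \<in> nodes {j+1..J} \<and>
        (q', q) \<in> (links {j+1..J})\<^sup>*"
      then obtain q' where q': "node_ball p \<inter> node_ball q' \<noteq> {}" "q' \<in> nodes {j+1..J}"
        "(q', q) \<in> (links {j+1..J})\<^sup>*"
        by blast
      then have "(q, r) \<in> links {j+1..J}"
        using r qr(3) connected_node[OF q'(3,2)] by (auto simp: links_def)
      with q' show ?thesis
        by (meson rtrancl_into_rtrancl)
    qed
  qed
qed

text \<open>Unless \<open>q\<close> is \<open>p\<close>, the point \<open>v\<close> lies in a chain
  of later generations that meets the ball of \<open>p\<close>. Such a chain adds less than
  \<open>\<rho> j\<close> to the radius.\<close>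

lemma dist_connected_center_aux:
  assumes IH: "\<And>p q u v. p \<in> nodes {j+1..J} \<Longrightarrow> (p, q) \<in> (links {j+1..J})\<^sup>* \<Longrightarrow>
      u \<in> node_ball p \<Longrightarrow> v \<in> node_ball q \<Longrightarrow> dist u v < 4 * \<rho> (j + 1)"
    and p: "p \<in> nodes {j..J}" "fst p = j" and pq: "(p, q) \<in> (links {j..J})\<^sup>*"
    and v: "v \<in> node_ball q"
  shows "dist (snd p) v < 2 * \<rho> j"
proof -
  have "q = p \<or> (\<exists>q'. node_ball p \<inter> node_ball q' \<noteq> {} \<and> q' \<in> nodes {j+1..J} \<and>
      (q', q) \<in> (links {j+1..J})\<^sup>*)"
    by (rule dist_connected_aux[OF _ p pq]) (rule IH)
  then show ?thesis
  proof
    assume "q = p"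
    then have "dist (snd p) v < \<rho> j"
      using v p by (auto simp: node_ball_def)
    then show ?thesis
      using scale_pos[of j] by linarith
  next
    assume "\<exists>q'. node_ball p \<inter> node_ball q' \<noteq> {} \<and> q' \<in> nodes {j+1..J} \<and>
        (q', q) \<in> (links {j+1..J})\<^sup>*"
    then obtain q' u where q': "q' \<in> nodes {j+1..J}" "(q', q) \<in> (links {j+1..J})\<^sup>*"
      and u: "u \<in> node_ball p" "u \<in> node_ball q'"
      by auto
    have "dist u v < \<rho> j"
      using IH[OF q' u(2) v] scale_Suc[of j] by simp
    moreover have "dist (snd p) u < \<rho> j"
      using u p(2) by (auto simp: node_ball_def)
    ultimately show ?thesis
      using dist_triangle[of "snd p" v u] by linarith
  qed
qed

text \<open>Induction on the number of generations. If the component has a ball of generation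
  \<open>j\<close>, everything lies within \<open>2 * \<rho> j\<close> of its centre; otherwise the
  bound for \<open>j + 1\<close> applies.\<close>

lemma dist_connected_finite:
  assumes "p \<in> nodes {j..J}" "(p, q) \<in> (links {j..J})\<^sup>*" "u \<in> node_ball p" "v \<in> node_ball q"
  shows "dist u v < 4 * \<rho> j"
proof -
  \<comment> \<open>Here \<open>n\<close> bounds the number of generations from \<open>j\<close> to
    \<open>J\<close>; for \<open>n = 0\<close> there are no nodes.\<close>
  have "dist u v < 4 * \<rho> j"
    if "J < j + int n" "p \<in> nodes {j..J}" "(p, q) \<in> (links {j..J})\<^sup>*"
      "u \<in> node_ball p" "v \<in> node_ball q" for n j p q u v
    using that
  proof (induction n arbitrary: j p q u v)
    case 0
    then show ?case
      by (auto simp: nodes_def)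
  next
    case (Suc n)
    have IH: "dist u v < 4 * \<rho> (j + 1)"
      if "p \<in> nodes {j+1..J}" "(p, q) \<in> (links {j+1..J})\<^sup>*"
        "u \<in> node_ball p" "v \<in> node_ball q" for p q u v
      using Suc.IH[of "j + 1"] Suc.prems(1) that by simp
    show ?case
    proof (cases "\<exists>b. (p, b) \<in> (links {j..J})\<^sup>* \<and> fst b = j")
      case True
      then obtain b where b: "(p, b) \<in> (links {j..J})\<^sup>*" "fst b = j"
        by blast
      then have bn: "b \<in> nodes {j..J}"
        using connected_node Suc.prems by blast
      have bp: "(b, p) \<in> (links {j..J})\<^sup>*"
        using b connected_sym by blast
      then have bq: "(b, q) \<in> (links {j..J})\<^sup>*"
        using Suc.prems(3) by (rule rtrancl_trans)
      have "dist (snd b) u < 2 * \<rho> j"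
        by (rule dist_connected_center_aux[OF _ bn b(2) bp Suc.prems(4)]) (rule IH)
      moreover have "dist (snd b) v < 2 * \<rho> j"
        by (rule dist_connected_center_aux[OF _ bn b(2) bq Suc.prems(5)]) (rule IH)
      ultimately show ?thesis
        using dist_triangle3[of u v "snd b"] by linarith
    next
      case False
      \<comment> \<open>The component avoids generation \<open>j\<close>, hence so does every link
        of the chain.\<close>
      have "(p, q) \<in> (links {j+1..J})\<^sup>*"
        using Suc.prems(3)
      proof (induction rule: rtrancl_induct)
        case base
        then show ?case by simp
      next
        case (step q r)
        have "(p, r) \<in> (links {j..J})\<^sup>*"
          using step.hyps by (rule rtrancl_into_rtrancl)
        then have "fst q \<noteq> j" "fst r \<noteq> j"
          using False step.hyps(1) by blast+
        then have "(q, r) \<in> links {j+1..J}"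
          using step.hyps by (auto simp: links_def nodes_def)
        with step.IH show ?case
          by (rule rtrancl_into_rtrancl)
      qed
      moreover have "fst p \<noteq> j"
        using False by blast
      then have "p \<in> nodes {j+1..J}"
        using Suc.prems(2) by (auto simp: nodes_def)
      ultimately show ?thesis
        using IH[OF _ _ Suc.prems(4,5)] scale_Suc[of j] scale_pos[of j] by fastforce
    qed
  qed
  from this[of j "nat (J - j + 1)" p q u v] assms show ?thesis
    by simp
qed

section \<open>Components as sets, and their largest balls\<close>

definition cluster :: "int \<Rightarrow> int \<times> 'a \<Rightarrow> 'a set" where
  "cluster j p = (\<Union>q\<in>{q. (p, q) \<in> (links {j..})\<^sup>*}. node_ball q)"

lemma node_ball_subset_cluster: "node_ball p \<subseteq> cluster j p"
  by (auto simp: cluster_def)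

lemma open_cluster: "open (cluster j p)"
  by (auto simp: cluster_def node_ball_def)

lemma cluster_subset_ball:
  assumes "p \<in> nodes {j..}" "fst p = j"
  shows "cluster j p \<subseteq> ball (snd p) (2 * \<rho> j)"
proof
  fix v assume "v \<in> cluster j p"
  then obtain q where q: "(p, q) \<in> (links {j..})\<^sup>*" "v \<in> node_ball q"
    by (auto simp: cluster_def)
  obtain J where J: "(p, q) \<in> (links {j..J})\<^sup>*"
    using connected_bounded_below[OF q(1)] .
  \<comment> \<open>The bound \<open>J\<close> may lie below \<open>j\<close>, for instance for a
    trivial chain; the maximum keeps generation \<open>j\<close> in the range.\<close>
  have J': "(p, q) \<in> (links {j..max j J})\<^sup>*"
    by (rule connected_mono[OF _ J]) auto
  have p: "p \<in> nodes {j..max j J}"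
    using assms by (auto simp: nodes_def)
  have "dist (snd p) v < 2 * \<rho> j"
    by (rule dist_connected_center_aux[OF _ p assms(2) J' q(2)]) (rule dist_connected_finite)
  then show "v \<in> ball (snd p) (2 * \<rho> j)"
    by simp
qed

lemma cluster_cong:
  assumes "(p, q) \<in> (links {j..})\<^sup>*"
  shows "cluster j p = cluster j q"
  using assms connected_sym unfolding cluster_def by (metis (no_types, lifting) rtrancl_trans)

text \<open>A common point lies in a ball of each cluster, and the link between these two balls
  joins the chains.\<close>

lemma clusters_disjoint:
  assumes "p \<in> nodes {j..}" "q \<in> nodes {j..}" "cluster j p \<noteq> cluster j q"
  shows "cluster j p \<inter> cluster j q = {}"
proof (rule ccontr)
  assume "cluster j p \<inter> cluster j q \<noteq> {}"
  then obtain p' q' where *: "(p, p') \<in> (links {j..})\<^sup>*" "(q, q') \<in> (links {j..})\<^sup>*"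
    "node_ball p' \<inter> node_ball q' \<noteq> {}"
    unfolding cluster_def by blast
  then have "(p', q') \<in> links {j..}"
    using connected_node[OF *(1) assms(1)] connected_node[OF *(2) assms(2)]
    by (simp add: links_def)
  with *(1) have "(p, q') \<in> (links {j..})\<^sup>*"
    by (rule rtrancl_into_rtrancl)
  then have "(p, q) \<in> (links {j..})\<^sup>*"
    using connected_sym[OF *(2)] by (rule rtrancl_trans)
  with assms(3) show False
    using cluster_cong by blast
qed

text \<open>This gives the nesting of the atoms: admitting earlier generations only adds
  links.\<close>

lemma cluster_mono: "j \<le> k \<Longrightarrow> cluster k p \<subseteq> cluster j p"
  unfolding cluster_def
  by (intro UN_mono Collect_mono impI order_refl connected_mono[of "{k..}" "{j..}"]) simp_all

text \<open>Take a node \<open>b\<close> of least generation in the component. Its chains stay in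
  generations from \<open>fst b\<close> on, so the component is also the cluster of \<open>b\<close>
  formed at its own generation, where \<open>cluster_subset_ball\<close> applies.\<close>

lemma exists_top_node:
  assumes p: "p \<in> nodes {j..}"
  obtains i x where "j \<le> i" "x \<in> S i" "ball x (\<rho> i) \<subseteq> cluster j p" "cluster j p \<subseteq> ball x (2 * \<rho> i)"
proof -
  define C where "C = {q. (p, q) \<in> (links {j..})\<^sup>*}"
  have C: "q \<in> nodes {j..}" if "q \<in> C" for q
    using that connected_node[OF _ p] by (simp add: C_def)
  have "\<exists>q. q \<in> C \<and> (\<forall>q'. q' \<in> C \<longrightarrow> nat (fst q - j) \<le> nat (fst q' - j))"
    by (rule ex_has_least_nat[where k = p]) (simp add: C_def)
  then obtain b where b: "b \<in> C" and least: "\<And>q. q \<in> C \<Longrightarrow> nat (fst b - j) \<le> nat (fst q - j)"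
    by blast
  have least': "fst b \<le> fst q" if "q \<in> C" for q
    using least[OF that] C[OF that] C[OF b] by (auto simp: nodes_def)
  have conn: "(b, q) \<in> (links {fst b..})\<^sup>*" if "(b, q) \<in> (links {j..})\<^sup>*" for q
    using that
  proof (induction rule: rtrancl_induct)
    case base
    then show ?case by simp
  next
    case (step q r)
    have "q \<in> C" "r \<in> C"
      using b step.hyps unfolding C_def
      by (auto intro: rtrancl_trans rtrancl_into_rtrancl)
    then have "(q, r) \<in> links {fst b..}"
      using step.hyps least' by (fastforce simp: links_def nodes_def)
    with step.IH show ?case
      by (rule rtrancl_into_rtrancl)
  qed
  have "cluster j p = cluster j b"
    using b cluster_cong by (simp add: C_def)
  moreover have "cluster j b \<subseteq> cluster (fst b) b"
    using conn by (auto simp: cluster_def)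
  moreover have "cluster (fst b) b \<subseteq> ball (snd b) (2 * \<rho> (fst b))"
    by (rule cluster_subset_ball) (use C[OF b] in \<open>auto simp: nodes_def\<close>)
  moreover have "ball (snd b) (\<rho> (fst b)) \<subseteq> cluster j b"
    using node_ball_subset_cluster[of b j] by (simp add: node_ball_def)
  ultimately show thesis
    using that[of "fst b" "snd b"] C[OF b] by (auto simp: nodes_def)
qed

end

subsection \<open>Null sets and doubling balls\<close>

lemma closed_msupport: "closed (msupport M)"
proof -
  have "- msupport M = \<Union>{U. open U \<and> emeasure M U = 0}"
    by (auto simp: msupport_def)
  then show ?thesis
    unfolding closed_def by (simp add: open_Union)
qed

text \<open>By the Lindelof property, countably many open null sets already cover the complement of
  the support.\<close>

lemma null_sets_compl_msupport:
  fixes M :: "'a::second_countable_topology measure"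
  assumes "sets M = sets borel"
  shows "- msupport M \<in> null_sets M"
proof -
  obtain \<U> where \<U>: "\<U> \<subseteq> {U. open U \<and> emeasure M U = 0}" "countable \<U>"
    "\<Union>\<U> = \<Union>{U. open U \<and> emeasure M U = 0}"
    using Lindelof[of "{U. open U \<and> emeasure M U = 0}"] by blast
  have "(\<Union>U\<in>\<U>. U) \<in> null_sets M"
    using \<U> assms by (intro null_sets_UN') (auto simp: null_sets_def)
  moreover have "- msupport M = \<Union>{U. open U \<and> emeasure M U = 0}"
    by (auto simp: msupport_def)
  ultimately show ?thesis
    using \<U> by simp
qed

lemma emeasure_Int_msupport:
  fixes M :: "'a::second_countable_topology measure"
  assumes "sets M = sets borel" "A \<in> sets borel"
  shows "emeasure M (A \<inter> msupport M) = emeasure M A"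
proof -
  have "A \<inter> msupport M = A - - msupport M"
    by auto
  then show ?thesis
    using emeasure_Diff_null_set[OF null_sets_compl_msupport[OF assms(1)], of A] assms by simp
qed

lemma radon_measure_finite_ball:
  fixes M :: "'a::heine_borel measure"
  assumes "radon_measure M"
  shows "emeasure M (ball x r) < \<infinity>"
proof -
  have "emeasure M (ball x r) \<le> emeasure M (cball x r)"
    using assms by (intro emeasure_mono) (auto simp: radon_measure_def)
  also have "\<dots> < \<infinity>"
    using assms compact_cball unfolding radon_measure_def by blast
  finally show ?thesis .
qed

text \<open>The set \<open>F\<close> is not assumed measurable, so the result is a null set around
  it: the intersection of covers of measure at most \<open>1 / Suc n\<close>.\<close>

lemma subset_null_set_of_small_covers:
  assumes "\<And>e::real. 0 < e \<Longrightarrow> \<exists>U\<in>sets M. F \<subseteq> U \<and> emeasure M U \<le> ennreal e"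
  obtains Z where "Z \<in> null_sets M" "F \<subseteq> Z"
proof -
  have "\<exists>U\<in>sets M. F \<subseteq> U \<and> emeasure M U \<le> ennreal (1 / real (Suc n))" for n
    using assms[of "1 / real (Suc n)"] by simp
  then obtain U where U: "\<And>n. U n \<in> sets M" "\<And>n. F \<subseteq> U n"
    "\<And>n. emeasure M (U n) \<le> ennreal (1 / real (Suc n))"
    by metis
  have Z: "(\<Inter>n. U n) \<in> sets M"
    using U(1) by auto
  have "emeasure M (\<Inter>n. U n) \<le> 0"
  proof (rule ennreal_le_epsilon)
    fix e :: real assume "0 < e"
    then obtain n where n: "1 / real (Suc n) < e"
      using nat_approx_posE by blast
    have "emeasure M (\<Inter>n. U n) \<le> emeasure M (U n)"
      using U(1) by (intro emeasure_mono) auto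
    also have "\<dots> \<le> ennreal e"
      using U(3)[of n] n by (meson ennreal_leI less_imp_le order_trans)
    finally show "emeasure M (\<Inter>n. U n) \<le> 0 + ennreal e"
      by simp
  qed
  with Z have "(\<Inter>n. U n) \<in> null_sets M"
    by (simp add: null_sets_def)
  with U(2) that show thesis
    by blast
qed

text \<open>Subadditivity on the sets \<open>A c\<close>, additivity on the disjoint sets
  \<open>B c\<close>. It serves for Vitali selections, where \<open>A c\<close> is a dilate of the
  ball \<open>B c\<close>.\<close>

lemma emeasure_UN_le_disjoint_UN:
  assumes C: "countable C" and AB: "\<And>c. c \<in> C \<Longrightarrow> A c \<in> sets M" "\<And>c. c \<in> C \<Longrightarrow> B c \<in> sets M"
    and le: "\<And>c. c \<in> C \<Longrightarrow> emeasure M (A c) \<le> k * emeasure M (B c)"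
    and disj: "disjoint_family_on B C"
  shows "emeasure M (\<Union>c\<in>C. A c) \<le> k * emeasure M (\<Union>c\<in>C. B c)"
proof -
  define g where "g X i = (if i \<in> to_nat_on C ` C then X (from_nat_into C i) else {})"
    for X :: "'a \<Rightarrow> 'b set" and i
  have UN: "(\<Union>i. g X i) = (\<Union>c\<in>C. X c)" for X
    using C by (auto simp: g_def split: if_splits)
  have sets: "range (g A) \<subseteq> sets M" "range (g B) \<subseteq> sets M"
    using AB C by (auto simp: g_def)
  have disjoint: "disjoint_family (g B)"
    using disj C by (fastforce simp: disjoint_family_on_def g_def)
  have "emeasure M (\<Union>i. g A i) \<le> (\<Sum>i. emeasure M (g A i))"
    by (rule emeasure_subadditive_countably[OF sets(1)])
  also have "\<dots> \<le> (\<Sum>i. k * emeasure M (g B i))"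
    using le C by (intro suminf_le summableI) (auto simp: g_def)
  also have "\<dots> = k * (\<Sum>i. emeasure M (g B i))"
    by (rule ennreal_suminf_cmult)
  also have "(\<Sum>i. emeasure M (g B i)) = emeasure M (\<Union>i. g B i)"
    by (rule suminf_emeasure[OF sets(2) disjoint])
  finally show ?thesis
    by (simp add: UN)
qed

text \<open>Outer regularity gives an open \<open>V\<close> around \<open>R\<close> with
  \<open>V - R\<close> of measure at most \<open>e\<close>. Small holes of \<open>R\<close> lie in
  \<open>V - R\<close>; Vitali's lemma selects disjoint ones whose 25-fold dilates cover
  \<open>R\<close>, and doubling bounds the measure of \<open>R\<close> by
  \<open>C * e\<close>.\<close>

lemma bounded_porous_null:
  fixes M :: "'a::euclidean_space measure"
  assumes M: "radon_measure M" and R: "R \<in> sets borel" "bounded R" and C: "0 < C"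
    and porous: "\<And>x e. x \<in> R \<Longrightarrow> 0 < e \<Longrightarrow> \<exists>y r. 0 < r \<and> r < e \<and> dist x y < 4 * r \<and>
      R \<inter> ball y r = {} \<and> emeasure M (ball y (25 * r)) \<le> ennreal C * emeasure M (ball y r)"
  shows "R \<in> null_sets M"
proof -
  have sets: "sets M = sets borel"
    using M by (simp add: radon_measure_def)
  obtain D where "R \<subseteq> ball 0 D"
    using R(2) bounded_subset_ballD by blast
  then have "emeasure M R \<le> emeasure M (ball 0 D)"
    by (intro emeasure_mono) (auto simp: sets)
  then have fin: "emeasure M R < \<infinity>"
    using radon_measure_finite_ball[OF M] by (metis order_le_less_trans)
  have "emeasure M R \<le> ennreal C * ennreal e" if "0 < e" for e :: real
  proof -
    have "(INF U\<in>{U. open U \<and> R \<subseteq> U}. emeasure M U) = emeasure M R"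
      using M R(1) by (auto simp: radon_measure_def)
    also have "\<dots> < emeasure M R + ennreal e"
      using fin that ennreal_add_left_cancel_less[of "emeasure M R" 0 "ennreal e"] by simp
    finally obtain V where V: "open V" "R \<subseteq> V" "emeasure M V < emeasure M R + ennreal e"
      by (auto simp: INF_less_iff)
    have "emeasure M (V - R) = emeasure M V - emeasure M R"
      using V fin R(1) sets by (intro emeasure_Diff) auto
    also have "\<dots> \<le> ennreal e"
      using V(3) fin by (auto simp: ennreal_minus_le_iff)
    finally have VR: "emeasure M (V - R) \<le> ennreal e" .
    \<comment> \<open>The ball of radius \<open>5 * r\<close> contains the point of \<open>R\<close>
      within \<open>4 * r\<close> of \<open>y\<close>; Vitali's lemma costs another factor 5, whence
      25. It also requires bounded radii, whence \<open>r \<le> 1\<close>.\<close>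
    define K where "K = {(y, r). 0 < r \<and> r \<le> 1 \<and> ball y (5 * r) \<subseteq> V \<and> R \<inter> ball y r = {} \<and>
      emeasure M (ball y (25 * r)) \<le> ennreal C * emeasure M (ball y r)}"
    have "R \<subseteq> (\<Union>p\<in>K. ball (fst p) (5 * snd p))"
    proof
      fix x assume x: "x \<in> R"
      then obtain \<delta> where \<delta>: "0 < \<delta>" "ball x \<delta> \<subseteq> V"
        using V openE by blast
      \<comment> \<open>The divisor is 4 + 5: \<open>ball y (5 * r)\<close> reaches less than
        \<open>9 * r\<close> from \<open>x\<close>.\<close>
      obtain y r where yr: "0 < r" "r < min 1 (\<delta> / 9)" "dist x y < 4 * r" "R \<inter> ball y r = {}"
        "emeasure M (ball y (25 * r)) \<le> ennreal C * emeasure M (ball y r)"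
        using porous[OF x, of "min 1 (\<delta> / 9)"] \<delta> by auto
      have "ball y (5 * r) \<subseteq> ball x \<delta>"
      proof
        fix w assume "w \<in> ball y (5 * r)"
        then show "w \<in> ball x \<delta>"
          using dist_triangle[of x w y] yr by simp
      qed
      then have "(y, r) \<in> K"
        using yr \<delta> by (auto simp: K_def)
      moreover have "x \<in> ball y (5 * r)"
        using yr by (simp add: dist_commute)
      ultimately show "x \<in> (\<Union>p\<in>K. ball (fst p) (5 * snd p))"
        by force
    qed
    moreover have "0 < 5 * snd p \<and> 5 * snd p \<le> 5" if "p \<in> K" for p
      using that by (auto simp: K_def)
    ultimately obtain L where L: "countable L" "L \<subseteq> K"
      "pairwise (\<lambda>p q. disjnt (ball (fst p) (5 * snd p)) (ball (fst q) (5 * snd q))) L"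
      "R \<subseteq> (\<Union>p\<in>L. ball (fst p) (5 * (5 * snd p)))"
      by (rule Vitali_covering_lemma_balls)
    have "emeasure M R \<le> emeasure M (\<Union>p\<in>L. ball (fst p) (25 * snd p))"
      using L by (intro emeasure_mono) (auto simp: sets)
    also have "\<dots> \<le> ennreal C * emeasure M (\<Union>p\<in>L. ball (fst p) (snd p))"
    proof (rule emeasure_UN_le_disjoint_UN[OF L(1)])
      have "ball (fst p) (snd p) \<subseteq> ball (fst p) (5 * snd p)" if "p \<in> L" for p
        using that L(2) by (intro subset_ball) (auto simp: K_def)
      with L(3) show "disjoint_family_on (\<lambda>p. ball (fst p) (snd p)) L"
        unfolding disjoint_family_on_def pairwise_def disjnt_def by blast
    qed (use L(2) in \<open>auto simp: K_def sets\<close>)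
    also have "\<dots> \<le> ennreal C * emeasure M (V - R)"
    proof (intro mult_left_mono emeasure_mono)
      have "ball (fst p) (snd p) \<subseteq> V - R" if "p \<in> L" for p
        using that L(2) subset_ball[of "snd p" "5 * snd p" "fst p"] by (force simp: K_def)
      then show "(\<Union>p\<in>L. ball (fst p) (snd p)) \<subseteq> V - R"
        by blast
    qed (use V R(1) in \<open>auto simp: sets\<close>)
    also have "\<dots> \<le> ennreal C * ennreal e"
      using VR by (rule mult_left_mono) simp
    finally show ?thesis .
  qed
  \<comment> \<open>The estimate is applied to \<open>e / C\<close>.\<close>
  then have le: "emeasure M R \<le> ennreal e" if "0 < e" for e
    using that C by (metis divide_pos_pos ennreal_mult less_imp_le mult.commute
        nonzero_eq_divide_eq order_less_irrefl)
  have "emeasure M R \<le> 0"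
    by (rule ennreal_le_epsilon) (simp add: le)
  then show ?thesis
    using R(1) sets by (simp add: null_sets_def)
qed

lemma porous_null:
  fixes M :: "'a::euclidean_space measure"
  assumes M: "radon_measure M" and R: "R \<in> sets borel" and C: "0 < C"
    and porous: "\<And>x e. x \<in> R \<Longrightarrow> 0 < e \<Longrightarrow> \<exists>y r. 0 < r \<and> r < e \<and> dist x y < 4 * r \<and>
      R \<inter> ball y r = {} \<and> emeasure M (ball y (25 * r)) \<le> ennreal C * emeasure M (ball y r)"
  shows "R \<in> null_sets M"
proof -
  have "R \<inter> ball 0 (real n) \<in> null_sets M" for n
  proof (rule bounded_porous_null[OF M _ _ C])
    fix x e assume "x \<in> R \<inter> ball 0 (real n)" "0 < (e::real)"
    then show "\<exists>y r. 0 < r \<and> r < e \<and> dist x y < 4 * r \<and> R \<inter> ball 0 (real n) \<inter> ball y r = {} \<and>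
        emeasure M (ball y (25 * r)) \<le> ennreal C * emeasure M (ball y r)"
      using porous[of x e] by blast
  qed (use R in auto)
  then have "(\<Union>n. R \<inter> ball 0 (real n)) \<in> null_sets M"
    by blast
  moreover have "(\<Union>n. R \<inter> ball 0 (real n)) = R"
    using reals_Archimedean2 by auto
  ultimately show ?thesis
    by simp
qed

section \<open>Grid counting, and doubling at almost every point\<close>

lemma dist_le_sqrt_card:
  fixes x y :: "real ^ 'd"
  assumes "\<And>i. \<bar>x $ i - y $ i\<bar> \<le> h"
  shows "dist x y \<le> sqrt (real CARD('d)) * h"
proof -
  have "0 \<le> h"
    using assms by (meson abs_ge_zero order_trans)
  have "dist x y \<le> L2_set (\<lambda>_::'d. h) UNIV"
    unfolding dist_vec_def using assms by (intro L2_set_mono) (auto simp: dist_real_def)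
  with \<open>0 \<le> h\<close> show ?thesis
    by (simp add: L2_set_constant)
qed

lemma dist_less_sqrt_card:
  fixes x y :: "real ^ 'd"
  assumes "\<And>i. \<bar>x $ i - y $ i\<bar> < h"
  shows "dist x y < sqrt (real CARD('d)) * h"
proof -
  have "0 < h"
    using assms by (meson abs_ge_zero order_le_less_trans)
  have "dist x y < L2_set (\<lambda>_::'d. h) UNIV"
    unfolding dist_vec_def using assms by (intro L2_set_strict_mono) (auto simp: dist_real_def)
  with \<open>0 < h\<close> show ?thesis
    by (simp add: L2_set_constant)
qed

lemma abs_diff_less_floor_eq:
  fixes a b h :: real
  assumes "\<lfloor>a / h\<rfloor> = \<lfloor>b / h\<rfloor>" "0 < h"
  shows "\<bar>a - b\<bar> < h"
proof -
  have "\<bar>a / h - b / h\<bar> < 1"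
    using assms(1) by linarith
  then show ?thesis
    using assms(2) by (simp add: abs_if field_simps split: if_splits)
qed

lemma scale_add:
  fixes \<rho> :: "int \<Rightarrow> real"
  assumes "\<And>i. \<rho> (i + 1) = \<rho> i / 4"
  shows "\<rho> (i + int n) = \<rho> i / 4 ^ n"
proof (induction n)
  case (Suc n)
  have "\<rho> (i + int (Suc n)) = \<rho> ((i + int n) + 1)"
    by (simp add: algebra_simps)
  also have "\<dots> = \<rho> i / 4 ^ Suc n"
    unfolding assms Suc.IH by simp
  finally show ?case .
qed simp

text \<open>Around a point that is not doubling at any scale beyond \<open>i\<^sub>0\<close>, dividing the radius by
  about \<open>\<alpha>\<close> divides the measure of the ball by more than \<open>C\<^sub>0\<close>, while the number of balls needed
  to cover a bounded set grows by a factor of at most \<open>(4 * \<alpha>) ^ CARD('d) < C\<^sub>0\<close>.\<close>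

lemma bounded_nondoubling_null:
  fixes M :: "(real ^ 'd) measure" and \<rho> :: "int \<Rightarrow> real"
  assumes M: "radon_measure M"
    and \<rho>_pos: "\<And>i. 0 < \<rho> i" and \<rho>_Suc: "\<And>i. \<rho> (i + 1) = \<rho> i / 4"
    and \<alpha>: "1 < \<alpha>" and C\<^sub>0: "(4 * \<alpha>) ^ CARD('d) < C\<^sub>0" and R: "0 < R"
  obtains Z where "Z \<in> null_sets M"
    "{x \<in> ball 0 R. \<forall>i\<ge>i\<^sub>0. \<not> emeasure M (ball x (\<alpha> * \<rho> i)) \<le> ennreal C\<^sub>0 * emeasure M (ball x (\<rho> i))} \<subseteq> Z"
proof -
  define F where "F = {x \<in> ball 0 R. \<forall>i\<ge>i\<^sub>0.
    \<not> emeasure M (ball x (\<alpha> * \<rho> i)) \<le> ennreal C\<^sub>0 * emeasure M (ball x (\<rho> i))}"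
  define D where "D = CARD('d)"
  define W where "W = measure M (ball 0 (R + \<rho> i\<^sub>0))"
  have sets: "sets M = sets borel"
    using M by (simp add: radon_measure_def)
  have fm: "ball x r \<in> fmeasurable M" for x r
    using radon_measure_finite_ball[OF M] sets by (simp add: fmeasurable_def)
  have em: "emeasure M (ball x r) = ennreal (measure M (ball x r))" for x r
    using fm by (simp add: emeasure_eq_measure2)
  have C\<^sub>0_pos: "0 < C\<^sub>0"
    using C\<^sub>0 \<alpha> by (smt (verit) zero_le_power)
  \<comment> \<open>The least power \<open>4 ^ m\<close> not below \<open>\<alpha>\<close> is less
    than \<open>4 * \<alpha>\<close>, so \<open>m\<close> generations absorb a dilation by
    \<open>\<alpha>\<close> while \<open>(4 ^ m) ^ D\<close> stays below
    \<open>C\<^sub>0\<close>.\<close>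
  have "\<exists>m. \<alpha> \<le> 4 ^ m"
    using real_arch_pow[of 4 \<alpha>] by (auto intro: less_imp_le)
  then obtain m where m: "\<alpha> \<le> 4 ^ m" and m_least: "\<And>k. k < m \<Longrightarrow> \<not> \<alpha> \<le> 4 ^ k"
    using exists_least_iff[of "\<lambda>m. \<alpha> \<le> 4 ^ m"] by blast
  have "m \<noteq> 0"
    by (rule notI) (use m \<alpha> in simp)
  then obtain m' where "m = Suc m'"
    using not0_implies_Suc by blast
  then have "4 ^ m < 4 * \<alpha>"
    using m_least[of m'] by simp
  then have "(4 ^ m) ^ D < (4 * \<alpha>) ^ D"
    by (intro power_strict_mono) (auto simp: D_def)
  then have b: "((4::real) ^ m) ^ D < C\<^sub>0"
    using C\<^sub>0 by (simp add: D_def)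
  \<comment> \<open>The ball of radius \<open>\<alpha> * \<rho> i\<close> lies in the ball
    \<open>m\<close> generations earlier, so failure of doubling gains a factor
    \<open>C\<^sub>0\<close> with each block of \<open>m\<close> generations.\<close>
  have decay: "C\<^sub>0 ^ p * measure M (ball x (\<rho> (i\<^sub>0 + int (m * p)))) \<le> W" if "x \<in> F" for x p
  proof (induction p)
    case 0
    have "ball x (\<rho> i\<^sub>0) \<subseteq> ball 0 (R + \<rho> i\<^sub>0)"
    proof
      fix w assume "w \<in> ball x (\<rho> i\<^sub>0)"
      then show "w \<in> ball 0 (R + \<rho> i\<^sub>0)"
        using that dist_triangle[of 0 w x] by (simp add: F_def)
    qed
    then show ?case
      using fm by (simp add: W_def measure_mono_fmeasurable fmeasurableD)
  next
    case (Suc p)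
    define i where "i = i\<^sub>0 + int (m * Suc p)"
    have "i = (i\<^sub>0 + int (m * p)) + int m"
      by (simp add: i_def)
    then have i: "4 ^ m * \<rho> i = \<rho> (i\<^sub>0 + int (m * p))"
      using scale_add[of \<rho> "i\<^sub>0 + int (m * p)" m, OF \<rho>_Suc] by simp
    have "i\<^sub>0 \<le> i"
      by (simp add: i_def)
    then have "\<not> ennreal (measure M (ball x (\<alpha> * \<rho> i))) \<le>
        ennreal C\<^sub>0 * ennreal (measure M (ball x (\<rho> i)))"
      using that by (simp add: F_def em)
    then have "\<not> measure M (ball x (\<alpha> * \<rho> i)) \<le> C\<^sub>0 * measure M (ball x (\<rho> i))"
      using C\<^sub>0_pos by (auto simp flip: ennreal_mult')
    then have "C\<^sub>0 * measure M (ball x (\<rho> i)) \<le> measure M (ball x (\<alpha> * \<rho> i))"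
      by simp
    also have "\<dots> \<le> measure M (ball x (4 ^ m * \<rho> i))"
      using fm m \<rho>_pos[of i]
      by (intro measure_mono_fmeasurable subset_ball) (auto simp: fmeasurableD intro: mult_right_mono)
    finally have "C\<^sub>0 ^ p * (C\<^sub>0 * measure M (ball x (\<rho> i))) \<le> C\<^sub>0 ^ p * measure M (ball x (\<rho> (i\<^sub>0 + int (m * p))))"
      using C\<^sub>0_pos by (intro mult_left_mono) (auto simp: i)
    with Suc.IH show ?case
      by (simp add: i_def mult_ac)
  qed
  obtain k\<^sub>0 :: nat where k\<^sub>0: "R * sqrt (real D) / \<rho> i\<^sub>0 \<le> real k\<^sub>0"
    using real_arch_simple by blast
  have k\<^sub>0_pos: "1 \<le> k\<^sub>0"
  proof -
    have "0 < R * sqrt (real D) / \<rho> i\<^sub>0"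
      using R \<rho>_pos[of i\<^sub>0] by (simp add: D_def)
    with k\<^sub>0 have "0 < real k\<^sub>0"
      by linarith
    then show ?thesis
      by simp
  qed
  have "\<exists>U\<in>sets M. F \<subseteq> U \<and> emeasure M U \<le> ennreal e" if e: "0 < e" for e
  proof -
    \<comment> \<open>At most \<open>(3 * k) ^ D\<close> cells, with
      \<open>k = k\<^sub>0 * 4 ^ (m * p)\<close>, each contribute at most
      \<open>W / C\<^sub>0 ^ p\<close>. The product is geometric in \<open>p\<close> with ratio
      below 1.\<close>
    have "(\<lambda>p. (3 * real k\<^sub>0) ^ D * W * (((4 ^ m) ^ D) / C\<^sub>0) ^ p) \<longlonglongrightarrow> (3 * real k\<^sub>0) ^ D * W * 0"
      using b C\<^sub>0_pos by (intro tendsto_mult_left LIMSEQ_power_zero) simp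
    then have "eventually (\<lambda>p. (3 * real k\<^sub>0) ^ D * W * (((4 ^ m) ^ D) / C\<^sub>0) ^ p < e) sequentially"
      using e by (intro order_tendstoD(2)) auto
    then obtain p where p: "(3 * real k\<^sub>0) ^ D * W * (((4 ^ m) ^ D) / C\<^sub>0) ^ p < e"
      by (auto simp: eventually_sequentially)
    define r where "r = \<rho> (i\<^sub>0 + int (m * p))"
    have r: "r = \<rho> i\<^sub>0 / 4 ^ (m * p)" "0 < r"
      using scale_add[of \<rho> i\<^sub>0 "m * p", OF \<rho>_Suc] \<rho>_pos by (auto simp: r_def)
    \<comment> \<open>With this mesh a cell has diameter \<open>r\<close>, so a ball of radius
      \<open>r\<close> about any point of a cell covers the cell.\<close>
    define h where "h = r / sqrt (real D)"
    have h: "0 < h" "sqrt (real D) * h = r"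
      using r(2) by (auto simp: h_def D_def)
    define \<kappa> where "\<kappa> x = (\<lambda>i. \<lfloor>x $ i / h\<rfloor>)" for x :: "real ^ 'd"
    define k where "k = k\<^sub>0 * 4 ^ (m * p)"
    have k: "1 \<le> k"
      using k\<^sub>0_pos by (simp add: k_def)
    have "\<kappa> x i \<in> {- int k..int k}" if "x \<in> F" for x i
    proof -
      from that have "\<bar>x $ i\<bar> \<le> R"
        using component_le_norm_cart[of x i] by (simp add: F_def)
      then have "\<bar>x $ i / h\<bar> \<le> R / h"
        using h by (simp add: divide_right_mono)
      also have "R / h = R * sqrt (real D) / \<rho> i\<^sub>0 * 4 ^ (m * p)"
        by (simp add: h_def r)
      also have "\<dots> \<le> real k\<^sub>0 * 4 ^ (m * p)"
        using k\<^sub>0 by (rule mult_right_mono) simp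
      finally have "\<bar>x $ i / h\<bar> \<le> real k"
        by (simp add: k_def)
      then have "- int k \<le> \<kappa> x i \<and> \<kappa> x i \<le> int k"
        unfolding \<kappa>_def by linarith
      then show ?thesis
        by simp
    qed
    then have "\<kappa> ` F \<subseteq> UNIV \<rightarrow>\<^sub>E {- int k..int k}"
      by (auto simp: PiE_UNIV_domain)
    moreover have "finite ((UNIV :: 'd set) \<rightarrow>\<^sub>E {- int k..int k})"
      by (intro finite_PiE) auto
    ultimately have fin: "finite (\<kappa> ` F)" and "card (\<kappa> ` F) \<le> card ((UNIV :: 'd set) \<rightarrow>\<^sub>E {- int k..int k})"
      by (auto intro: finite_subset card_mono)
    then have "card (\<kappa> ` F) \<le> (2 * k + 1) ^ D"
      by (simp add: card_funcsetE D_def nat_add_distrib nat_mult_distrib)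
    also have "\<dots> \<le> (3 * k) ^ D"
      using k by (intro power_mono) auto
    finally have card: "real (card (\<kappa> ` F)) \<le> (3 * real k) ^ D"
      by (metis of_nat_le_iff of_nat_mult of_nat_numeral of_nat_power)
    \<comment> \<open>One point for each occupied cell; it has to be a point of \<open>F\<close> for
      \<open>decay\<close> to apply.\<close>
    define y where "y = inv_into F \<kappa>"
    have y: "y c \<in> F" "\<kappa> (y c) = c" if "c \<in> \<kappa> ` F" for c
      using that by (auto simp: y_def inv_into_into f_inv_into_f)
    define U where "U = (\<Union>c\<in>\<kappa> ` F. ball (y c) r)"
    have "F \<subseteq> U"
    proof
      fix x assume x: "x \<in> F"
      have "\<kappa> (y (\<kappa> x)) = \<kappa> x"
        using x y by blast
      then have "dist (y (\<kappa> x)) x < sqrt (real D) * h"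
        unfolding D_def using h
        by (intro dist_less_sqrt_card abs_diff_less_floor_eq) (auto simp: \<kappa>_def fun_eq_iff)
      with x h show "x \<in> U"
        by (auto simp: U_def)
    qed
    moreover have U: "U \<in> fmeasurable M"
      unfolding U_def using fin fm by (intro fmeasurable.finite_UN) auto
    moreover have "measure M U \<le> e"
    proof -
      have "measure M U \<le> (\<Sum>c\<in>\<kappa> ` F. measure M (ball (y c) r))"
        unfolding U_def using fin fm by (intro measure_UNION_le) (auto simp: sets)
      also have "\<dots> \<le> (\<Sum>c\<in>\<kappa> ` F. W / C\<^sub>0 ^ p)"
        using decay[OF y(1), of _ p] C\<^sub>0_pos
        by (intro sum_mono) (simp add: r_def pos_le_divide_eq mult_ac)
      also have "\<dots> = real (card (\<kappa> ` F)) * (W / C\<^sub>0 ^ p)"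
        by simp
      also have "\<dots> \<le> (3 * real k) ^ D * (W / C\<^sub>0 ^ p)"
        using card C\<^sub>0_pos by (intro mult_right_mono) (auto simp: W_def)
      also have "\<dots> = (3 * real k\<^sub>0) ^ D * W * (((4 ^ m) ^ D) / C\<^sub>0) ^ p"
        by (simp add: k_def power_mult_distrib power_divide mult_ac flip: power_mult)
      finally show ?thesis
        using p by simp
    qed
    then have "emeasure M U \<le> ennreal e"
      using U by (simp add: emeasure_eq_measure2 ennreal_leI)
    ultimately show ?thesis
      by (blast dest: fmeasurableD)
  qed
  then obtain Z where "Z \<in> null_sets M" "F \<subseteq> Z"
    by (rule subset_null_set_of_small_covers)
  with that show thesis
    unfolding F_def by blast
qed

text \<open>An exceptional point lies in some ball around 0 and is non-doubling from some generation
  on. This leaves countably many sets, each treated by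
  \<open>bounded_nondoubling_null\<close>.\<close>

lemma doubling_at_small_scales:
  fixes M :: "(real ^ 'd) measure" and \<rho> :: "int \<Rightarrow> real"
  assumes M: "radon_measure M"
    and \<rho>_pos: "\<And>i. 0 < \<rho> i" and \<rho>_Suc: "\<And>i. \<rho> (i + 1) = \<rho> i / 4"
    and \<alpha>: "1 < \<alpha>" and C\<^sub>0: "(4 * \<alpha>) ^ CARD('d) < C\<^sub>0"
  obtains Z where "Z \<in> null_sets M"
    "\<And>x j. x \<notin> Z \<Longrightarrow> \<exists>i\<ge>j. emeasure M (ball x (\<alpha> * \<rho> i)) \<le> ennreal C\<^sub>0 * emeasure M (ball x (\<rho> i))"
proof -
  define F where "F i\<^sub>0 n = {x \<in> ball 0 (real (Suc n)). \<forall>i\<ge>i\<^sub>0.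
    \<not> emeasure M (ball x (\<alpha> * \<rho> i)) \<le> ennreal C\<^sub>0 * emeasure M (ball x (\<rho> i))}" for i\<^sub>0 n
  have "\<exists>Z\<in>null_sets M. F i\<^sub>0 n \<subseteq> Z" for i\<^sub>0 n
    by (rule bounded_nondoubling_null[OF M _ _ \<alpha> C\<^sub>0, of \<rho> "real (Suc n)" i\<^sub>0])
      (use \<rho>_pos \<rho>_Suc in \<open>auto simp: F_def\<close>)
  then obtain Z where Z: "\<And>i\<^sub>0 n. Z i\<^sub>0 n \<in> null_sets M" "\<And>i\<^sub>0 n. F i\<^sub>0 n \<subseteq> Z i\<^sub>0 n"
    by metis
  show thesis
  proof
    show "(\<Union>i\<^sub>0. \<Union>n. Z i\<^sub>0 n) \<in> null_sets M"
      using Z(1) by (intro null_sets_UN) auto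
    fix x j assume x: "x \<notin> (\<Union>i\<^sub>0. \<Union>n. Z i\<^sub>0 n)"
    obtain n where "norm x < real n"
      using reals_Archimedean2 by blast
    then have "x \<in> ball 0 (real (Suc n))"
      by simp
    with x Z(2)[of j n] show "\<exists>i\<ge>j. emeasure M (ball x (\<alpha> * \<rho> i)) \<le> ennreal C\<^sub>0 * emeasure M (ball x (\<rho> i))"
      unfolding F_def by blast
  qed
qed

subsection \<open>Filtrations capturing doubling cubes\<close>

text \<open>This builds the filtration of one colour, with prescribed centres \<open>P\<close>. The
  attached radius is exactly \<open>\<rho> i\<close> for their atoms, so it can be compared with the
  sides of the captured cubes.\<close>

lemma filtration_of_doubling_balls:
  fixes M :: "(real ^ 'd) measure" and \<rho> :: "int \<Rightarrow> real" and P :: "int \<Rightarrow> (real ^ 'd) set"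
  assumes M: "radon_measure M"
    and \<rho>_pos: "\<And>i. 0 < \<rho> i" and \<rho>_Suc: "\<And>i. \<rho> (i + 1) = \<rho> i / 4"
    and \<alpha>: "25 \<le> \<alpha>" and C\<^sub>0: "(4 * \<alpha>) ^ CARD('d) < C\<^sub>0"
    and P_pos: "\<And>i x. x \<in> P i \<Longrightarrow> 0 < emeasure M (ball x (\<rho> i))"
    and P_doubling: "\<And>i x. x \<in> P i \<Longrightarrow>
      emeasure M (ball x (\<alpha> * \<rho> i)) \<le> ennreal C\<^sub>0 * emeasure M (ball x (\<rho> i))"
    and P_sep: "\<And>i x y. x \<in> P i \<Longrightarrow> y \<in> P i \<Longrightarrow> x \<noteq> y \<Longrightarrow> 4 * \<rho> i \<le> dist x y"
  shows "\<exists>\<S> z r. atomic_filtration M \<S> \<and> atoms_near_balls M \<alpha> C\<^sub>0 \<S> z r \<and>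
    (\<forall>i. \<forall>x\<in>P i. \<exists>T\<in>\<S> i. r i T = \<rho> i \<and> ball x (\<rho> i) \<inter> msupport M \<subseteq> T \<and> T \<subseteq> ball x (2 * \<rho> i))"
proof -
  have sets: "sets M = sets borel"
    using M by (simp add: radon_measure_def)
  have supp: "msupport M \<in> sets borel"
    by (simp add: closed_msupport borel_closed)
  have C\<^sub>0_pos: "0 < C\<^sub>0"
    using C\<^sub>0 \<alpha> by (smt (verit) zero_le_power)
  define E where "E i = {x. 0 < emeasure M (ball x (\<rho> i)) \<and>
    emeasure M (ball x (\<alpha> * \<rho> i)) \<le> ennreal C\<^sub>0 * emeasure M (ball x (\<rho> i))}" for i
  have "\<exists>S. P i \<subseteq> S \<and> S \<subseteq> E i \<and> (\<forall>x\<in>S. \<forall>y\<in>S. x \<noteq> y \<longrightarrow> 4 * \<rho> i \<le> dist x y) \<and>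
      (\<forall>x\<in>E i. \<exists>y\<in>S. dist x y < 4 * \<rho> i)" for i
  proof -
    have "P i \<subseteq> E i"
      using P_pos P_doubling by (auto simp: E_def)
    moreover have "0 < 4 * \<rho> i"
      using \<rho>_pos by simp
    ultimately show ?thesis
      using P_sep by (rule maximal_separated_superset)
  qed
  then obtain S where S: "\<And>i. P i \<subseteq> S i" "\<And>i. S i \<subseteq> E i"
    "\<And>i x y. x \<in> S i \<Longrightarrow> y \<in> S i \<Longrightarrow> x \<noteq> y \<Longrightarrow> 4 * \<rho> i \<le> dist x y"
    "\<And>i x. x \<in> E i \<Longrightarrow> \<exists>y\<in>S i. dist x y < 4 * \<rho> i"
    by metis
  interpret scaled_nets \<rho> S
    by unfold_locales (use \<rho>_pos \<rho>_Suc S(3) in auto)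

  define G where "G j = (\<Union>p\<in>nodes {j..}. node_ball p)" for j
  have open_G: "open (G j)" for j
    by (auto simp: G_def node_ball_def)
  have null: "msupport M - G j \<in> null_sets M" for j
  proof -
    have "1 < \<alpha>"
      using \<alpha> by simp
    then obtain Z where Z: "Z \<in> null_sets M" and doubling: "\<And>x j. x \<notin> Z \<Longrightarrow>
        \<exists>i\<ge>j. emeasure M (ball x (\<alpha> * \<rho> i)) \<le> ennreal C\<^sub>0 * emeasure M (ball x (\<rho> i))"
      using doubling_at_small_scales[of M \<rho> \<alpha> C\<^sub>0] M \<rho>_pos \<rho>_Suc C\<^sub>0 by blast
    \<comment> \<open>Off \<open>Z\<close> there are doubling balls at arbitrarily small scales, and
      they have positive measure at points of the support. Maximality then gives a net ball nearby,
      which lies in \<open>G j\<close> and so is a hole of \<open>R\<close>.\<close>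
    define R where "R = msupport M - G j - Z"
    have Z_sets: "Z \<in> sets borel"
      using Z sets by auto
    have "R \<in> null_sets M"
    proof (rule porous_null[OF M _ C\<^sub>0_pos])
      show "R \<in> sets borel"
        unfolding R_def using supp open_G Z_sets by (intro sets.Diff) auto
      fix x and e :: real assume x: "x \<in> R" and e: "0 < e"
      obtain n where n: "\<rho> 0 / e < 4 ^ n"
        using real_arch_pow[of 4 "\<rho> 0 / e"] by auto
      \<comment> \<open>The bound by \<open>j\<close> puts the net ball into \<open>G j\<close>; the
        bound by \<open>n\<close> makes its radius less than \<open>e\<close>.\<close>
      obtain i where i: "max j (int n) \<le> i"
        "emeasure M (ball x (\<alpha> * \<rho> i)) \<le> ennreal C\<^sub>0 * emeasure M (ball x (\<rho> i))"
        using doubling x unfolding R_def by blast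
      have "\<rho> i = \<rho> 0 / 4 ^ nat i"
        using scale_add[of \<rho> 0 "nat i"] \<rho>_Suc i(1) by simp
      also have "\<dots> \<le> \<rho> 0 / 4 ^ n"
        using i(1) \<rho>_pos[of 0] by (intro divide_left_mono power_increasing) auto
      also have "\<dots> < e"
        using n e by (simp add: field_simps)
      finally have "\<rho> i < e" .
      have "0 < emeasure M (ball x (\<rho> i))"
        using x \<rho>_pos[of i] by (auto simp: R_def msupport_def)
      then obtain y where y: "y \<in> S i" "dist x y < 4 * \<rho> i"
        using i(2) S(4)[of x i] by (auto simp: E_def)
      have "(i, y) \<in> nodes {j..}"
        using y i(1) by (simp add: nodes_def)
      then have "ball y (\<rho> i) \<subseteq> G j"
        by (force simp: G_def node_ball_def)
      then have "R \<inter> ball y (\<rho> i) = {}"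
        by (auto simp: R_def)
      moreover have "emeasure M (ball y (25 * \<rho> i)) \<le> ennreal C\<^sub>0 * emeasure M (ball y (\<rho> i))"
      proof -
        have "emeasure M (ball y (25 * \<rho> i)) \<le> emeasure M (ball y (\<alpha> * \<rho> i))"
          using \<alpha> \<rho>_pos[of i] by (intro emeasure_mono subset_ball mult_right_mono) (auto simp: sets)
        also have "\<dots> \<le> ennreal C\<^sub>0 * emeasure M (ball y (\<rho> i))"
          using y S(2) by (auto simp: E_def)
        finally show ?thesis .
      qed
      ultimately show "\<exists>y r. 0 < r \<and> r < e \<and> dist x y < 4 * r \<and> R \<inter> ball y r = {} \<and>
          emeasure M (ball y (25 * r)) \<le> ennreal C\<^sub>0 * emeasure M (ball y r)"
        using \<rho>_pos \<open>\<rho> i < e\<close> y by blast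
    qed
    then have "R \<union> Z \<in> null_sets M"
      using Z by auto
    moreover have "msupport M - G j \<subseteq> R \<union> Z"
      by (auto simp: R_def)
    moreover have "msupport M - G j \<in> sets M"
      unfolding sets using supp open_G by (intro sets.Diff) auto
    ultimately show ?thesis
      using null_sets_subset by blast
  qed

  define \<S> where "\<S> j = (\<lambda>p. cluster j p \<inter> msupport M) ` nodes {j..}" for j
  have Union_\<S>: "\<Union>(\<S> j) = G j \<inter> msupport M" for j
  proof -
    have "cluster j p \<subseteq> G j" if "p \<in> nodes {j..}" for p
      using connected_node[OF _ that] by (auto simp: cluster_def G_def)
    moreover have "G j \<subseteq> (\<Union>p\<in>nodes {j..}. cluster j p)"
      unfolding G_def by (intro UN_mono order_refl node_ball_subset_cluster)
    ultimately show ?thesis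
      by (auto simp: \<S>_def)
  qed
  \<comment> \<open>Admissible balls have positive measure and therefore meet the support; a
    partition must not contain the empty set.\<close>
  have nonempty: "cluster j p \<inter> msupport M \<noteq> {}" if "p \<in> nodes {j..}" for j p
  proof -
    have "snd p \<in> E (fst p)"
      using that S(2)[of "fst p"] by (auto simp: nodes_def)
    then have "0 < emeasure M (node_ball p)"
      by (simp add: node_ball_def E_def)
    also have "\<dots> = emeasure M (node_ball p \<inter> msupport M)"
      by (rule emeasure_Int_msupport[symmetric]) (auto simp: sets node_ball_def)
    finally have "node_ball p \<inter> msupport M \<noteq> {}"
      by auto
    then show ?thesis
      using node_ball_subset_cluster by blast
  qed
  have "atomic_filtration M \<S>"
    unfolding atomic_filtration_def
  proof (intro conjI allI ballI)
    fix j
    have "partition_on (msupport M - (msupport M - G j)) (\<S> j)"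
    proof (rule partition_onI)
      show "\<Union>(\<S> j) = msupport M - (msupport M - G j)"
        using Union_\<S> by auto
      show "{} \<notin> \<S> j"
        using nonempty by (force simp: \<S>_def)
      fix T T' assume "T \<in> \<S> j" "T' \<in> \<S> j" "T \<noteq> T'"
      then obtain p q where pq: "p \<in> nodes {j..}" "q \<in> nodes {j..}" "cluster j p \<noteq> cluster j q"
        and "T = cluster j p \<inter> msupport M" "T' = cluster j q \<inter> msupport M"
        unfolding \<S>_def by blast
      with clusters_disjoint[OF pq] show "disjnt T T'"
        by (auto simp: disjnt_def)
    qed
    with null show "\<exists>Z\<in>null_sets M. partition_on (msupport M - Z) (\<S> j)"
      by blast
    have "countable (cluster j ` nodes {j..})"
    proof (rule countable_disjoint_open_subsets)
      show "pairwise disjnt (cluster j ` nodes {j..})"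
        using clusters_disjoint unfolding pairwise_def disjnt_def by blast
    qed (auto simp: open_cluster)
    moreover have "\<S> j = (\<lambda>V. V \<inter> msupport M) ` cluster j ` nodes {j..}"
      by (simp add: \<S>_def image_image)
    ultimately show "countable (\<S> j)"
      by simp
    show "\<S> j \<subseteq> sets borel"
      using supp open_cluster by (auto simp: \<S>_def intro!: sets.Int)
  next
    fix j T assume "T \<in> \<S> (j + 1)"
    then obtain p where p: "p \<in> nodes {j + 1..}" "T = cluster (j + 1) p \<inter> msupport M"
      by (auto simp: \<S>_def)
    then have "p \<in> nodes {j..}"
      by (auto simp: nodes_def)
    moreover have "T \<subseteq> cluster j p \<inter> msupport M"
      using p cluster_mono[of j "j + 1" p] by auto
    ultimately show "\<exists>T'\<in>\<S> j. T \<subseteq> T'"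
      unfolding \<S>_def by blast
  qed

  \<comment> \<open>The attached ball must be a function of \<open>j\<close> and the set
    \<open>T\<close>, which several nodes may fit. Choosing the least generation gives the radius
    \<open>\<rho> i\<close> for a prescribed \<open>x\<close> in \<open>P i\<close>: at level
    \<open>i\<close> the node \<open>(i, x)\<close> is good and no good node is earlier. The chosen
    centre may still differ from \<open>x\<close>.\<close>
  define good where "good j T i x \<longleftrightarrow> j \<le> i \<and> x \<in> S i \<and> ball x (\<rho> i) \<inter> msupport M \<subseteq> T \<and>
    T \<subseteq> ball x (2 * \<rho> i) \<inter> msupport M" for j T i x
  define minimal where "minimal j T i x \<longleftrightarrow> good j T i x \<and> (\<forall>i' x'. good j T i' x' \<longrightarrow> i \<le> i')"
    for j T i x
  have "\<exists>i x. minimal j T i x" if T: "T \<in> \<S> j" for j T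
  proof -
    obtain p where p: "p \<in> nodes {j..}" "T = cluster j p \<inter> msupport M"
      using T by (auto simp: \<S>_def)
    obtain i x where "j \<le> i" "x \<in> S i" "ball x (\<rho> i) \<subseteq> cluster j p" "cluster j p \<subseteq> ball x (2 * \<rho> i)"
      using exists_top_node[OF p(1)] .
    then have "good j T i x"
      using p(2) by (auto simp: good_def)
    then have "\<exists>q. case_prod (good j T) q \<and>
        (\<forall>q'. case_prod (good j T) q' \<longrightarrow> nat (fst q - j) \<le> nat (fst q' - j))"
      by (intro ex_has_least_nat[where k = "(i, x)"]) simp
    then obtain i x where ix: "good j T i x"
      "\<And>i' x'. good j T i' x' \<Longrightarrow> nat (i - j) \<le> nat (i' - j)"
      by auto
    have "i \<le> i'" if "good j T i' x'" for i' x'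
      using ix(2)[OF that] ix(1) that by (auto simp: good_def)
    with ix(1) show ?thesis
      unfolding minimal_def by blast
  qed
  moreover define gen where "gen j T = (SOME i. \<exists>x. minimal j T i x)" for j T
  moreover define z where "z j T = (SOME x. minimal j T (gen j T) x)" for j T
  ultimately have "minimal j T (gen j T) (z j T)" if "T \<in> \<S> j" for j T
    using that by (metis (mono_tags, lifting) someI_ex)
  then have gen: "\<And>j T. T \<in> \<S> j \<Longrightarrow> good j T (gen j T) (z j T)"
    and gen_least: "\<And>j T i x. T \<in> \<S> j \<Longrightarrow> good j T i x \<Longrightarrow> gen j T \<le> i"
    unfolding minimal_def by blast+
  define r where "r j T = \<rho> (gen j T)" for j T
  have "atoms_near_balls M \<alpha> C\<^sub>0 \<S> z r"
    unfolding atoms_near_balls_def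
  proof (intro allI ballI conjI)
    fix j T assume T: "T \<in> \<S> j"
    note g = gen[OF T, unfolded good_def]
    show "0 < r j T"
      by (simp add: r_def \<rho>_pos)
    show "ball (z j T) (r j T) \<inter> msupport M \<subseteq> T"
      using g by (simp add: r_def)
    have "ball (z j T) (2 * r j T) \<subseteq> ball (z j T) (30 * r j T)"
      using \<rho>_pos[of "gen j T"] by (intro subset_ball) (simp add: r_def)
    then show "T \<subseteq> ball (z j T) (30 * r j T) \<inter> msupport M"
      using g by (auto simp: r_def)
    show "emeasure M (ball (z j T) (\<alpha> * r j T)) \<le> ennreal C\<^sub>0 * emeasure M (ball (z j T) (r j T))"
      using g S(2) by (auto simp: r_def E_def)
  qed
  moreover have "\<exists>T\<in>\<S> i. r i T = \<rho> i \<and> ball x (\<rho> i) \<inter> msupport M \<subseteq> T \<and> T \<subseteq> ball x (2 * \<rho> i)"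
    if x: "x \<in> P i" for i x
  proof -
    define T where "T = cluster i (i, x) \<inter> msupport M"
    have node: "(i, x) \<in> nodes {i..}"
      using x S(1) by (auto simp: nodes_def)
    then have T: "T \<in> \<S> i"
      by (auto simp: T_def \<S>_def)
    have "ball x (\<rho> i) \<subseteq> cluster i (i, x)" "cluster i (i, x) \<subseteq> ball x (2 * \<rho> i)"
      using node_ball_subset_cluster[of "(i, x)" i] cluster_subset_ball[OF node]
      by (simp_all add: node_ball_def)
    then have *: "ball x (\<rho> i) \<inter> msupport M \<subseteq> T" "T \<subseteq> ball x (2 * \<rho> i) \<inter> msupport M"
      by (auto simp: T_def)
    then have "good i T i x"
      using x S(1) by (auto simp: good_def)
    then have "gen i T = i"
      using gen_least[OF T] gen[OF T] by (force simp: good_def)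
    with T * show ?thesis
      by (intro bexI[of _ T]) (auto simp: r_def)
  qed
  ultimately show ?thesis
    using \<open>atomic_filtration M \<S>\<close> by blast
qed

section \<open>Inclusions between cubes and balls\<close>

lemma mem_cube: "y \<in> cube x l \<longleftrightarrow> (\<forall>k. \<bar>y $ k - x $ k\<bar> \<le> l / 2)"
  unfolding cube_def mem_box_cart abs_diff_le_iff by auto

text \<open>The half diagonal of the cube is \<open>sqrt d * (l / 2)\<close>; the inequality is
  strict because the cube is closed and the ball open.\<close>

lemma cube_subset_ball:
  fixes x y :: "real ^ 'd"
  assumes "sqrt (real CARD('d)) * (l / 2) + dist x y < r"
  shows "cube x l \<subseteq> ball y r"
proof
  fix w assume "w \<in> cube x l"
  then have "dist w x \<le> sqrt (real CARD('d)) * (l / 2)"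
    by (intro dist_le_sqrt_card) (simp add: mem_cube)
  then show "w \<in> ball y r"
    using assms dist_triangle[of y w x] by (simp add: dist_commute)
qed

lemma ball_subset_cube:
  fixes x y :: "real ^ 'd"
  assumes "dist x y + r \<le> l / 2"
  shows "ball y r \<subseteq> cube x l"
proof
  fix w assume "w \<in> ball y r"
  then have "dist w x \<le> l / 2"
    using assms dist_triangle[of w x y] by (simp add: dist_commute)
  then show "w \<in> cube x l"
    unfolding mem_cube dist_norm
    by (metis component_le_norm_cart order_trans vector_minus_component)
qed

lemma cube_sets_borel: "cube x l \<in> sets borel"
  by (simp add: cube_def)

section \<open>Colouring the grid and capturing the doubling cubes\<close>

theorem theorem1:
  "\<exists>N::nat. \<forall>(n::real) (\<alpha>::real) (C\<^sub>0::real) (\<alpha>\<^sub>0::real).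
     0 < n \<and> n \<le> real CARD('d::finite) \<and> \<alpha> > 60 \<and>
     C\<^sub>0 > (6 * sqrt (real CARD('d)) * \<alpha>) ^ CARD('d) \<and>
     \<alpha>\<^sub>0 = 6 * sqrt (real CARD('d)) * \<alpha> \<longrightarrow>
     (\<exists>c\<ge>1::real. \<forall>\<mu> :: (real ^ 'd) measure. polynomial_growth n \<mu> \<longrightarrow>
        (\<exists>(\<Sigma> :: nat \<Rightarrow> int \<Rightarrow> (real ^ 'd) set set)
          (z :: nat \<Rightarrow> int \<Rightarrow> (real ^ 'd) set \<Rightarrow> real ^ 'd)
          (r :: nat \<Rightarrow> int \<Rightarrow> (real ^ 'd) set \<Rightarrow> real).
           (\<forall>k\<in>{1..N}. atomic_filtration \<mu> (\<Sigma> k) \<and>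
                       atoms_near_balls \<mu> \<alpha> C\<^sub>0 (\<Sigma> k) (z k) (r k)) \<and>
           (\<forall>x l. doubling_cube \<mu> \<alpha>\<^sub>0 C\<^sub>0 x l \<longrightarrow>
              (\<exists>k\<in>{1..N}. \<exists>j. \<exists>T\<in>\<Sigma> k j.
                 cube x l \<inter> msupport \<mu> \<subseteq> T \<and>
                 inverse c * r k j T \<le> l \<and> l \<le> c * r k j T \<and>
                 ennreal (inverse c) * emeasure \<mu> T \<le> emeasure \<mu> (cube x l) \<and>
                 emeasure \<mu> (cube x l) \<le> ennreal c * emeasure \<mu> T))))"
proof -
  define sd where "sd = sqrt (real CARD('d))"
  have sd: "1 \<le> sd"
    by (simp add: sd_def Suc_leI)
  \<comment> \<open>Distinct cells of one colour differ by at least \<open>m\<close> in some index,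
    so their points are more than \<open>m - 1\<close> meshes apart; 12 is the separation factor 4
    times the 3 in \<open>\<rho>\<close>.\<close>
  define m where "m = \<lceil>12 * sd\<rceil> + 1"
  have m: "12 * sd \<le> real_of_int m - 1" "0 < m"
    using sd unfolding m_def by linarith+
  define colours where "colours = (UNIV :: 'd set) \<rightarrow>\<^sub>E {0..<m}"
  have "finite colours"
    unfolding colours_def by (intro finite_PiE) auto
  then obtain colour where colour: "bij_betw colour {1..card colours} colours"
    using ex_bij_betw_nat_finite_1 by blast
  define s where "s i = (4::real) powr (- real_of_int i)" for i :: int
  have s_pos: "0 < s i" and s_Suc: "s (i + 1) = s i / 4" for i
    by (auto simp: s_def powr_diff algebra_simps powr_minus_divide powr_add)
  \<comment> \<open>The half diagonal of a cube of side below \<open>4 * s i\<close> is below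
    \<open>2 * sd * s i\<close>, and a cell has diameter \<open>sd * s i\<close>; hence the factor
    3.\<close>
  define \<rho> where "\<rho> i = 3 * sd * s i" for i
  have \<rho>_pos: "0 < \<rho> i" and \<rho>_Suc: "\<rho> (i + 1) = \<rho> i / 4" for i
    using sd by (auto simp: \<rho>_def s_pos s_Suc)
  define cell where "cell i x = (\<lambda>k. \<lfloor>x $ k / s i\<rfloor>)" for i and x :: "real ^ 'd"
  have dist_cell: "dist x y < sd * s i" if "cell i x = cell i y" for i x y
    unfolding sd_def using that s_pos
    by (intro dist_less_sqrt_card abs_diff_less_floor_eq) (auto simp: cell_def fun_eq_iff)
  have dist_distinct_cells: "4 * \<rho> i \<le> dist x y"
    if ne: "cell i x \<noteq> cell i y" and eq: "(\<lambda>k. cell i x k mod m) = (\<lambda>k. cell i y k mod m)" for i x y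
  proof -
    obtain k where k: "cell i x k \<noteq> cell i y k"
      using ne by (auto simp: fun_eq_iff)
    moreover have "cell i x k mod m = cell i y k mod m"
      using eq by meson
    \<comment> \<open>The difference of the indices is a nonzero multiple of
      \<open>m\<close>.\<close>
    ultimately have "m \<le> \<bar>cell i x k - cell i y k\<bar>"
      by (metis dvd_imp_le_int mod_eq_dvd_iff abs_of_pos m(2) right_minus_eq)
    then have "real_of_int m - 1 \<le> \<bar>x $ k / s i - y $ k / s i\<bar>"
      unfolding cell_def by linarith
    with m(1) have "12 * sd \<le> \<bar>x $ k / s i - y $ k / s i\<bar>"
      by linarith
    then have "4 * \<rho> i \<le> \<bar>x $ k - y $ k\<bar>"
      using s_pos[of i] by (simp add: \<rho>_def abs_if field_simps split: if_splits)
    also have "\<dots> \<le> dist x y"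
      using component_le_norm_cart[of "x - y" k] by (simp add: dist_norm)
    finally show ?thesis .
  qed
  show ?thesis
  proof (intro exI[of _ "card colours"] allI impI)
    fix n \<alpha> C\<^sub>0 \<alpha>\<^sub>0 :: real
    assume "0 < n \<and> n \<le> real CARD('d) \<and> \<alpha> > 60 \<and>
      C\<^sub>0 > (6 * sqrt (real CARD('d)) * \<alpha>) ^ CARD('d) \<and> \<alpha>\<^sub>0 = 6 * sqrt (real CARD('d)) * \<alpha>"
    then have \<alpha>: "60 < \<alpha>" and C\<^sub>0: "(6 * sd * \<alpha>) ^ CARD('d) < C\<^sub>0" and \<alpha>\<^sub>0: "\<alpha>\<^sub>0 = 6 * sd * \<alpha>"
      by (auto simp: sd_def)
    then have \<alpha>': "25 \<le> \<alpha>"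
      by simp
    have sd_\<alpha>: "60 * sd \<le> sd * \<alpha>"
      using sd \<alpha> by simp
    have "1 \<le> 6 * sd * \<alpha>"
      using sd sd_\<alpha> unfolding mult.assoc by linarith
    \<comment> \<open>Hence \<open>C\<^sub>0\<close> dominates the constants needed later and can
      itself serve as the comparability constant.\<close>
    then have "6 * sd * \<alpha> \<le> (6 * sd * \<alpha>) ^ CARD('d)"
      by (intro self_le_power) auto
    with C\<^sub>0 have C\<^sub>0_ge: "6 * (sd * \<alpha>) \<le> C\<^sub>0"
      by simp
    have C\<^sub>0_ge': "4 \<le> C\<^sub>0"
      using C\<^sub>0_ge sd_\<alpha> sd by linarith
    have C\<^sub>0_ge'': "3 * sd \<le> C\<^sub>0"
      using C\<^sub>0_ge sd_\<alpha> sd by linarith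
    have "(4 * \<alpha>) ^ CARD('d) \<le> (6 * sd * \<alpha>) ^ CARD('d)"
      using sd \<alpha> by (intro power_mono mult_right_mono) auto
    with C\<^sub>0 have C\<^sub>0': "(4 * \<alpha>) ^ CARD('d) < C\<^sub>0"
      by linarith
    show "\<exists>c\<ge>1::real. \<forall>\<mu> :: (real ^ 'd) measure. polynomial_growth n \<mu> \<longrightarrow>
        (\<exists>(\<Sigma> :: nat \<Rightarrow> int \<Rightarrow> (real ^ 'd) set set)
          (z :: nat \<Rightarrow> int \<Rightarrow> (real ^ 'd) set \<Rightarrow> real ^ 'd)
          (r :: nat \<Rightarrow> int \<Rightarrow> (real ^ 'd) set \<Rightarrow> real).
           (\<forall>k\<in>{1..card colours}. atomic_filtration \<mu> (\<Sigma> k) \<and>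
                       atoms_near_balls \<mu> \<alpha> C\<^sub>0 (\<Sigma> k) (z k) (r k)) \<and>
           (\<forall>x l. doubling_cube \<mu> \<alpha>\<^sub>0 C\<^sub>0 x l \<longrightarrow>
              (\<exists>k\<in>{1..card colours}. \<exists>j. \<exists>T\<in>\<Sigma> k j.
                 cube x l \<inter> msupport \<mu> \<subseteq> T \<and>
                 inverse c * r k j T \<le> l \<and> l \<le> c * r k j T \<and>
                 ennreal (inverse c) * emeasure \<mu> T \<le> emeasure \<mu> (cube x l) \<and>
                 emeasure \<mu> (cube x l) \<le> ennreal c * emeasure \<mu> T)))"
    proof (intro exI[of _ C\<^sub>0] conjI allI impI)
      show "1 \<le> C\<^sub>0"
        using C\<^sub>0_ge' by simp
      fix \<mu> :: "(real ^ 'd) measure"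
      assume "polynomial_growth n \<mu>"
      then have \<mu>: "radon_measure \<mu>"
        by (simp add: polynomial_growth_def)
      then have sets: "sets \<mu> = sets borel"
        by (simp add: radon_measure_def)
      define centre where "centre i x \<longleftrightarrow>
        (\<exists>l. s i \<le> l \<and> l < 4 * s i \<and> doubling_cube \<mu> \<alpha>\<^sub>0 C\<^sub>0 x l)" for i x
      \<comment> \<open>One centre per cell; the equation \<open>x = rep i (cell i x)\<close> in
        \<open>P\<close> discards all others, so distinct points of \<open>P f i\<close> lie in
        distinct cells.\<close>
      define rep where "rep i c = (SOME x. centre i x \<and> cell i x = c)" for i c
      define P where "P f i = {x. centre i x \<and> x = rep i (cell i x) \<and> (\<lambda>k. cell i x k mod m) = f}"
        for f i
      have P: "0 < emeasure \<mu> (ball x (\<rho> i))"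
        "emeasure \<mu> (ball x (\<alpha> * \<rho> i)) \<le> ennreal C\<^sub>0 * emeasure \<mu> (ball x (\<rho> i))"
        if x: "x \<in> P f i" for f i x
      proof -
        obtain l where l: "s i \<le> l" "l < 4 * s i" "doubling_cube \<mu> \<alpha>\<^sub>0 C\<^sub>0 x l"
          using x by (auto simp: P_def centre_def)
        have "sd * (l / 2) < sd * (3 * s i)"
          using sd l s_pos[of i] by (intro mult_strict_left_mono) auto
        then have "cube x l \<subseteq> ball x (\<rho> i)"
          by (intro cube_subset_ball) (simp add: sd_def \<rho>_def)
        then have le: "emeasure \<mu> (cube x l) \<le> emeasure \<mu> (ball x (\<rho> i))"
          by (intro emeasure_mono) (auto simp: sets)
        with l(3) show "0 < emeasure \<mu> (ball x (\<rho> i))"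
          by (auto simp: doubling_cube_def)
        \<comment> \<open>This is where \<open>\<alpha>\<^sub>0\<close> comes from:
          \<open>\<alpha> * \<rho> i\<close> is at most \<open>3 * sd * \<alpha> * l\<close>, half
          the side of the dilated cube.\<close>
        have "(sd * \<alpha>) * (3 * s i) \<le> (sd * \<alpha>) * (3 * l)"
          using sd sd_\<alpha> l(1) by (intro mult_left_mono) auto
        then have "ball x (\<alpha> * \<rho> i) \<subseteq> cube x (\<alpha>\<^sub>0 * l)"
          by (intro ball_subset_cube) (simp add: \<alpha>\<^sub>0 \<rho>_def mult_ac)
        then have "emeasure \<mu> (ball x (\<alpha> * \<rho> i)) \<le> emeasure \<mu> (cube x (\<alpha>\<^sub>0 * l))"
          by (intro emeasure_mono) (auto simp: sets cube_sets_borel)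
        also have "\<dots> \<le> ennreal C\<^sub>0 * emeasure \<mu> (cube x l)"
          using l(3) by (simp add: doubling_cube_def)
        also have "\<dots> \<le> ennreal C\<^sub>0 * emeasure \<mu> (ball x (\<rho> i))"
          using le by (rule mult_left_mono) simp
        finally show "emeasure \<mu> (ball x (\<alpha> * \<rho> i)) \<le> ennreal C\<^sub>0 * emeasure \<mu> (ball x (\<rho> i))" .
      qed
      have P_sep: "4 * \<rho> i \<le> dist x y" if "x \<in> P f i" "y \<in> P f i" "x \<noteq> y" for f i x y
      proof -
        have "x = rep i (cell i x)" "(\<lambda>k. cell i x k mod m) = f"
          "y = rep i (cell i y)" "(\<lambda>k. cell i y k mod m) = f"
          using that(1,2) unfolding P_def by blast+
        with that(3) show ?thesis
          by (intro dist_distinct_cells) metis+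
      qed
      have "\<exists>\<S> z r. atomic_filtration \<mu> \<S> \<and> atoms_near_balls \<mu> \<alpha> C\<^sub>0 \<S> z r \<and>
          (\<forall>i. \<forall>x\<in>P f i. \<exists>T\<in>\<S> i. r i T = \<rho> i \<and> ball x (\<rho> i) \<inter> msupport \<mu> \<subseteq> T \<and>
            T \<subseteq> ball x (2 * \<rho> i))" for f
        using \<mu> \<rho>_pos \<rho>_Suc \<alpha>' C\<^sub>0' P P_sep
        by (rule filtration_of_doubling_balls[where \<rho> = \<rho> and P = "P f"])
      then obtain \<S> z r where filt: "\<And>f. atomic_filtration \<mu> (\<S> f)"
        "\<And>f. atoms_near_balls \<mu> \<alpha> C\<^sub>0 (\<S> f) (z f) (r f)"
        and capture: "\<And>f i x. x \<in> P f i \<Longrightarrow> \<exists>T\<in>\<S> f i. r f i T = \<rho> i \<and>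
          ball x (\<rho> i) \<inter> msupport \<mu> \<subseteq> T \<and> T \<subseteq> ball x (2 * \<rho> i)"
        by metis
      have captured: "\<exists>k\<in>{1..card colours}. \<exists>j. \<exists>T\<in>\<S> (colour k) j.
          cube x l \<inter> msupport \<mu> \<subseteq> T \<and>
          inverse C\<^sub>0 * r (colour k) j T \<le> l \<and> l \<le> C\<^sub>0 * r (colour k) j T \<and>
          ennreal (inverse C\<^sub>0) * emeasure \<mu> T \<le> emeasure \<mu> (cube x l) \<and>
          emeasure \<mu> (cube x l) \<le> ennreal C\<^sub>0 * emeasure \<mu> T"
        if Q: "doubling_cube \<mu> \<alpha>\<^sub>0 C\<^sub>0 x l" for x l
      proof -
        have l: "0 < l"
          using Q by (simp add: doubling_cube_def)
        define i where "i = - \<lfloor>log 4 l\<rfloor>"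
        have "s i \<le> l" "l < 4 * s i"
          using floor_log_eq_powr_iff[of l 4 "\<lfloor>log 4 l\<rfloor>"] l by (auto simp: s_def i_def powr_add)
        define c where "c = cell i x"
        have "centre i x"
          using Q \<open>s i \<le> l\<close> \<open>l < 4 * s i\<close> by (auto simp: centre_def)
        \<comment> \<open>The point \<open>x\<close> witnesses the choice; the representative may be
          the centre of another doubling cube of this generation.\<close>
        then have rep: "centre i (rep i c)" "cell i (rep i c) = c"
          unfolding rep_def c_def by (metis (mono_tags, lifting) someI_ex)+
        define f where "f = (\<lambda>k. c k mod m)"
        have "f \<in> colours"
          using m(2) by (auto simp: f_def colours_def)
        then obtain k where k: "k \<in> {1..card colours}" "colour k = f"
          using colour unfolding bij_betw_def by (metis imageE)
        have "rep i c \<in> P f i"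
          using rep by (simp add: P_def f_def)
        then obtain T where T: "T \<in> \<S> f i" "r f i T = \<rho> i"
          "ball (rep i c) (\<rho> i) \<inter> msupport \<mu> \<subseteq> T" "T \<subseteq> ball (rep i c) (2 * \<rho> i)"
          using capture by blast
        have T_sets: "T \<in> sets \<mu>"
          using filt(1)[of f] T(1) by (auto simp: atomic_filtration_def sets)
        have dist: "dist x (rep i c) < sd * s i"
          by (rule dist_cell) (use rep(2) in \<open>simp add: c_def\<close>)
        have "sd * (l / 2) \<le> sd * (2 * s i)"
          using sd \<open>l < 4 * s i\<close> by (intro mult_left_mono) auto
        also have "\<dots> = 2 * (sd * s i)"
          by simp
        finally have "sd * (l / 2) + dist x (rep i c) < 3 * (sd * s i)"
          using dist by linarith
        then have "cube x l \<subseteq> ball (rep i c) (\<rho> i)"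
          by (intro cube_subset_ball) (simp only: sd_def \<rho>_def mult.assoc)
        with T(3) have sub: "cube x l \<inter> msupport \<mu> \<subseteq> T"
          by blast
        \<comment> \<open>Here 7 = 6 + 1: \<open>T\<close> lies within \<open>2 * \<rho> i\<close>,
          that is \<open>6 * sd * s i\<close>, of the representative, which is within
          \<open>sd * s i\<close> of \<open>x\<close>. The right side is half of
          \<open>\<alpha>\<^sub>0 * l\<close>.\<close>
        have sT: "7 * (sd * s i) \<le> 3 * (sd * \<alpha> * l)"
        proof -
          have "sd * (60 * s i) \<le> sd * (\<alpha> * l)"
            using sd \<alpha> \<open>s i \<le> l\<close> s_pos[of i] by (intro mult_left_mono mult_mono) auto
          then show ?thesis
            using sd s_pos[of i] by (simp add: mult_ac)
        qed
        have "T \<subseteq> cube x (\<alpha>\<^sub>0 * l)"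
          using T(4) dist sT ball_subset_cube[of x "rep i c" "2 * \<rho> i" "\<alpha>\<^sub>0 * l"]
          by (auto simp: \<alpha>\<^sub>0 \<rho>_def mult_ac)
        then have "emeasure \<mu> T \<le> emeasure \<mu> (cube x (\<alpha>\<^sub>0 * l))"
          by (intro emeasure_mono) (auto simp: sets cube_sets_borel)
        also have "\<dots> \<le> ennreal C\<^sub>0 * emeasure \<mu> (cube x l)"
          using Q by (simp add: doubling_cube_def)
        finally have "ennreal (inverse C\<^sub>0) * emeasure \<mu> T \<le>
            ennreal (inverse C\<^sub>0) * (ennreal C\<^sub>0 * emeasure \<mu> (cube x l))"
          by (rule mult_left_mono) simp
        also have "\<dots> = emeasure \<mu> (cube x l)"
          using C\<^sub>0_ge' by (simp flip: mult.assoc ennreal_mult')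
        finally have 1: "ennreal (inverse C\<^sub>0) * emeasure \<mu> T \<le> emeasure \<mu> (cube x l)" .
        \<comment> \<open>Only the trace of the cube on the support is known to lie in
          \<open>T\<close>; it carries the whole measure of the cube.\<close>
        have "emeasure \<mu> (cube x l) = emeasure \<mu> (cube x l \<inter> msupport \<mu>)"
          by (simp add: emeasure_Int_msupport sets cube_sets_borel)
        also have "\<dots> \<le> emeasure \<mu> T"
          using sub T_sets by (rule emeasure_mono)
        also have "\<dots> \<le> ennreal C\<^sub>0 * emeasure \<mu> T"
          using mult_right_mono[of 1 "ennreal C\<^sub>0" "emeasure \<mu> T"] C\<^sub>0_ge' by simp
        finally have 2: "emeasure \<mu> (cube x l) \<le> ennreal C\<^sub>0 * emeasure \<mu> T" .
        have "\<rho> i \<le> C\<^sub>0 * l"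
          unfolding \<rho>_def using C\<^sub>0_ge'' C\<^sub>0_ge' s_pos[of i] \<open>s i \<le> l\<close> by (intro mult_mono) auto
        then have 3: "inverse C\<^sub>0 * r f i T \<le> l"
          using C\<^sub>0_ge' by (simp add: T(2) field_simps)
        have "4 * s i \<le> C\<^sub>0 * (3 * sd) * s i"
          using C\<^sub>0_ge' sd s_pos[of i] mult_mono[of 4 C\<^sub>0 1 "3 * sd"]
          by (intro mult_right_mono) auto
        with \<open>l < 4 * s i\<close> have 4: "l \<le> C\<^sub>0 * r f i T"
          by (simp add: T(2) \<rho>_def mult_ac)
        show ?thesis
          using k T(1) sub 1 2 3 4 by blast
      qed
      show "\<exists>\<Sigma> z r. (\<forall>k\<in>{1..card colours}. atomic_filtration \<mu> (\<Sigma> k) \<and>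
              atoms_near_balls \<mu> \<alpha> C\<^sub>0 (\<Sigma> k) (z k) (r k)) \<and>
            (\<forall>x l. doubling_cube \<mu> \<alpha>\<^sub>0 C\<^sub>0 x l \<longrightarrow>
              (\<exists>k\<in>{1..card colours}. \<exists>j. \<exists>T\<in>\<Sigma> k j.
                 cube x l \<inter> msupport \<mu> \<subseteq> T \<and>
                 inverse C\<^sub>0 * r k j T \<le> l \<and> l \<le> C\<^sub>0 * r k j T \<and>
                 ennreal (inverse C\<^sub>0) * emeasure \<mu> T \<le> emeasure \<mu> (cube x l) \<and>
                 emeasure \<mu> (cube x l) \<le> ennreal C\<^sub>0 * emeasure \<mu> T))"
        using filt captured
        by (intro exI[of _ "\<lambda>k. \<S> (colour k)"] exI[of _ "\<lambda>k. z (colour k)"]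
            exI[of _ "\<lambda>k. r (colour k)"]) simp
    qed
  qed
qed

end
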